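(* Let $I$ be an ideal minimally generated by $q\ge 1$ square-free monomials $m_1,\dots,m_q$ in a polynomial ring $R=\mathsf{k}[x_1,\dots,x_n]$ over a field $\mathsf{k}$, and let $r$ be a positive integer. Then: (1) $\overline{I^r}=I^r+\psi_I\big(\overline{\mathcal{E}_q^{\,r}}\smallsetminus\mathcal{E}_q^{\,r}\big)R$; (2) if $r\ge 2$, $q\ge 4$ and $\psi_I(g(r,q))\notin I^r$, then $\overline{I^r}\neq I^r$; (3) if $q\le 3$, then $\overline{I^r}=I^r$; (4) if $q=4$, then the following are equivalent: (a) $\overline{I^s}=I^s$ for all $s\ge 1$; (b) $\overline{I^2}=I^2$; (c) $\gcd(m_a,m_b)\mid \mathrm{lcm}(m_c,m_d)$ for some $a,b,c,d$ with $\{a,b,c,d\}=\{1,2,3,4\}$; (5) if $q=5$, then the following are equivalent: (a) $\overline{I^s}=I^s$ for all $s\ge 1$; (b) $\overline{I^2}=I^2$ and $\overline{I^3}=I^3$.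
   Context: Let $\mathsf{k}$ be a field, $q\ge 1$, $[q]=\{1,\dots,q\}$, and $S_{[q]}=\mathsf{k}[y_A : \emptyset\neq A\subseteq[q]]$. For $i\in[q]$ set $\epsilon_i=\prod_{A\subseteq[q],\, i\in A}y_A$. The $q$-extremal ideal is $\mathcal{E}_q=(\epsilon_1,\dots,\epsilon_q)\subseteq S_{[q]}$. $\psi_I\colon S_{[q]}\to R$ is the $\mathsf{k}$-algebra homomorphism with $\psi_I(y_A)$ equal to the product of all variables $x_k$ ($k\in[n]$) such that for every $j\in[q]$: $x_k\mid m_j \iff j\in A$ (empty product $=1$). For a subset $X$ of $S_{[q]}$, $\psi_I(X)R$ is the ideal of $R$ generated by $\psi_I(X)$. For $r\ge 2$, $q\ge 4$, $$g(r,q)=\Big(\prod_{A\subseteq[q],\,|A|\ge 1}y_A\Big)\Big(\prod_{A\subseteq[q],\,|A|\ge 3}y_A\Big)\epsilon_1^{\,r-2}\in S_{[q]}.$$ $\overline{J}$ denotes the integral closure of an ideal $J$ in its ambient polynomial ring. *)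

theory Defs
  imports "HOL-Library.Poly_Mapping" "HOL-Algebra.Ideal_Product" "HOL-Algebra.Divisibility"
begin

section \<open>Polynomial rings in a prescribed set of variables\<close>

text \<open>
  A polynomial is a finitely supported map from exponent vectors to coefficients. The type
  allows arbitrarily many variables; the ring \<open>mpoly_ring V\<close> consists of the
  polynomials whose variables all lie in \<open>V\<close>.
\<close>

type_synonym ('v, 'k) mpoly = "('v \<Rightarrow>\<^sub>0 nat) \<Rightarrow>\<^sub>0 'k"

definition mp_const :: "'k::comm_ring_1 \<Rightarrow> ('v, 'k) mpoly" where
  "mp_const c = Poly_Mapping.single 0 c"

definition mp_var :: "'v \<Rightarrow> ('v, 'k::comm_ring_1) mpoly" where
  "mp_var v = Poly_Mapping.single (Poly_Mapping.single v 1) 1"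

definition mpoly_ring :: "'v set \<Rightarrow> ('v, 'k::comm_ring_1) mpoly ring" where
  "mpoly_ring V =
    \<lparr> carrier = {p. \<forall>e \<in> Poly_Mapping.keys p. Poly_Mapping.keys e \<subseteq> V},
      monoid.mult = (*), one = 1, ring.zero = 0, ring.add = (+) \<rparr>"

definition mp_subst :: "('v \<Rightarrow> ('w, 'k) mpoly) \<Rightarrow> ('v, 'k::comm_ring_1) mpoly \<Rightarrow> ('w, 'k) mpoly" where
  "mp_subst f p =
    (\<Sum>e \<in> Poly_Mapping.keys p.
      mp_const (Poly_Mapping.lookup p e) *
      (\<Prod>v \<in> Poly_Mapping.keys e. f v ^ Poly_Mapping.lookup e v))"

definition squarefree_monomial :: "'v set \<Rightarrow> ('v, 'k::comm_ring_1) mpoly \<Rightarrow> bool" where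
  "squarefree_monomial V p \<longleftrightarrow> (\<exists>F. finite F \<and> F \<subseteq> V \<and> p = (\<Prod>v\<in>F. mp_var v))"


section \<open>Ideals\<close>

text \<open>
  Powers of ideals are powers in the semiring \<open>ideals_set R\<close>, so that the zeroth
  power is the whole ring.
\<close>

definition integral_closure :: "('a, 'b) ring_scheme \<Rightarrow> 'a set \<Rightarrow> 'a set" where
  "integral_closure R J =
    {z \<in> carrier R. \<exists>d::nat. d \<ge> 1 \<and>
      (\<exists>a. (\<forall>i \<in> {1..d}. a i \<in> J [^]\<^bsub>ideals_set R\<^esub> i) \<and>
        z [^]\<^bsub>R\<^esub> d \<oplus>\<^bsub>R\<^esub> (\<Oplus>\<^bsub>R\<^esub>i\<in>{1..d}. a i \<otimes>\<^bsub>R\<^esub> z [^]\<^bsub>R\<^esub> (d - i)) = \<zero>\<^bsub>R\<^esub>)}"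

text \<open>Ranging over proper index subsets also forces the generators to be distinct.\<close>

definition minimally_generated_by ::
  "('a, 'b) ring_scheme \<Rightarrow> 'a set \<Rightarrow> nat \<Rightarrow> (nat \<Rightarrow> 'a) \<Rightarrow> bool" where
  "minimally_generated_by R I q m \<longleftrightarrow>
    m ` {1..q} \<subseteq> carrier R \<and> I = Idl\<^bsub>R\<^esub> (m ` {1..q}) \<and>
    (\<forall>T. T \<subset> {1..q} \<longrightarrow> Idl\<^bsub>R\<^esub> (m ` T) \<noteq> I)"


section \<open>Extremal ideals\<close>

text \<open>The variables \<open>y\<^sub>A\<close> are indexed by the nonempty subsets \<open>A\<close> of \<open>{1..q}\<close>.\<close>

definition extremal_ring :: "nat \<Rightarrow> (nat set, 'k::comm_ring_1) mpoly ring" where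
  "extremal_ring q = mpoly_ring (Pow {1..q} - {{}})"

definition extremal_gen :: "nat \<Rightarrow> nat \<Rightarrow> (nat set, 'k::comm_ring_1) mpoly" where
  "extremal_gen q i = (\<Prod>A \<in> {A. A \<subseteq> {1..q} \<and> i \<in> A}. mp_var A)"

definition extremal_ideal :: "nat \<Rightarrow> (nat set, 'k::comm_ring_1) mpoly set" where
  "extremal_ideal q = Idl\<^bsub>extremal_ring q\<^esub> (extremal_gen q ` {1..q})"

definition psi_var ::
  "nat \<Rightarrow> nat \<Rightarrow> (nat \<Rightarrow> (nat, 'k::comm_ring_1) mpoly) \<Rightarrow> nat set \<Rightarrow> (nat, 'k) mpoly" where
  "psi_var n q m A =
    (\<Prod>k \<in> {k \<in> {1..n}. \<forall>j \<in> {1..q}. mp_var k divides\<^bsub>mpoly_ring {1..n}\<^esub> m j \<longleftrightarrow> j \<in> A}. mp_var k)"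

definition psi ::
  "nat \<Rightarrow> nat \<Rightarrow> (nat \<Rightarrow> (nat, 'k::comm_ring_1) mpoly) \<Rightarrow> (nat set, 'k) mpoly \<Rightarrow> (nat, 'k) mpoly" where
  "psi n q m = mp_subst (psi_var n q m)"

text \<open>Used only for \<open>r \<ge> 2\<close> and \<open>q \<ge> 4\<close>; for \<open>r < 2\<close> the exponent is truncated.\<close>

definition extremal_g :: "nat \<Rightarrow> nat \<Rightarrow> (nat set, 'k::comm_ring_1) mpoly" where
  "extremal_g r q =
    (\<Prod>A \<in> {A. A \<subseteq> {1..q} \<and> card A \<ge> 1}. mp_var A) *
    (\<Prod>A \<in> {A. A \<subseteq> {1..q} \<and> card A \<ge> 3}. mp_var A) *
    extremal_gen q 1 ^ (r - 2)"


section \<open>Basic facts\<close>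

lemma mpoly_ring_simps [simp]:
  "monoid.mult (mpoly_ring V) = (*)" "one (mpoly_ring V) = 1"
  "ring.zero (mpoly_ring V) = 0" "ring.add (mpoly_ring V) = (+)"
  by (simp_all add: mpoly_ring_def)

lemma mpoly_ring_carrier:
  "p \<in> carrier (mpoly_ring V) \<longleftrightarrow> (\<forall>e \<in> Poly_Mapping.keys p. Poly_Mapping.keys e \<subseteq> V)"
  by (simp add: mpoly_ring_def)

lemma mpoly_ring_closed:
  shows "0 \<in> carrier (mpoly_ring V)" "1 \<in> carrier (mpoly_ring V)"
    and "mp_const c \<in> carrier (mpoly_ring V)"
    and "v \<in> V \<Longrightarrow> mp_var v \<in> carrier (mpoly_ring V)"
    and "p \<in> carrier (mpoly_ring V) \<Longrightarrow> q \<in> carrier (mpoly_ring V) \<Longrightarrow> p + q \<in> carrier (mpoly_ring V)"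
    and "p \<in> carrier (mpoly_ring V) \<Longrightarrow> q \<in> carrier (mpoly_ring V) \<Longrightarrow> p * q \<in> carrier (mpoly_ring V)"
    and "p \<in> carrier (mpoly_ring V) \<Longrightarrow> - p \<in> carrier (mpoly_ring V)"
proof -
  show "p \<in> carrier (mpoly_ring V) \<Longrightarrow> q \<in> carrier (mpoly_ring V) \<Longrightarrow> p + q \<in> carrier (mpoly_ring V)"
    using Poly_Mapping.keys_add[of p q] by (auto simp: mpoly_ring_carrier)
  show "p * q \<in> carrier (mpoly_ring V)"
    if p: "p \<in> carrier (mpoly_ring V)" and q: "q \<in> carrier (mpoly_ring V)"
    unfolding mpoly_ring_carrier
  proof
    fix e assume "e \<in> Poly_Mapping.keys (p * q)"
    then obtain a b where e: "e = a + b" and "a \<in> Poly_Mapping.keys p" "b \<in> Poly_Mapping.keys q"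
      using keys_mult[of p q] by blast
    then have "Poly_Mapping.keys a \<subseteq> V" "Poly_Mapping.keys b \<subseteq> V"
      using p q by (auto simp: mpoly_ring_carrier)
    then show "Poly_Mapping.keys e \<subseteq> V"
      using Poly_Mapping.keys_add[of a b] by (auto simp: e)
  qed
qed (auto simp: mpoly_ring_carrier mp_const_def mp_var_def)

lemma cring_mpoly_ring:
  fixes V :: "'v set"
  shows "cring (mpoly_ring V :: ('v, 'k::comm_ring_1) mpoly ring)" (is "cring ?R")
proof (rule cringI)
  show "abelian_group ?R"
  proof (rule abelian_groupI)
    fix x assume "x \<in> carrier ?R"
    then show "\<exists>y\<in>carrier ?R. y \<oplus>\<^bsub>?R\<^esub> x = \<zero>\<^bsub>?R\<^esub>"
      using mpoly_ring_closed(7)[of x V] by (intro bexI[of _ "- x"]) simp_all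
  qed (simp_all add: mpoly_ring_closed algebra_simps)
  show "Group.comm_monoid ?R"
    by (rule comm_monoidI) (simp_all add: mpoly_ring_closed algebra_simps)
qed (simp add: algebra_simps)

text \<open>
  The next lemmas confirm that \<open>mp_subst f\<close> is the \<open>'k\<close>-algebra homomorphism sending
  each variable \<open>v\<close> to \<open>f v\<close>.
\<close>

lemma mp_const_arith:
  "mp_const 0 = 0" "mp_const 1 = 1"
  "mp_const (a + b) = mp_const a + mp_const b"
  "mp_const (a * b) = mp_const a * mp_const b"
  by (simp_all add: mp_const_def single_add mult_single)

lemma mp_subst_superset:
  assumes "finite E" "Poly_Mapping.keys p \<subseteq> E"
  shows "mp_subst f p = (\<Sum>e \<in> E. mp_const (Poly_Mapping.lookup p e) *
      (\<Prod>v \<in> Poly_Mapping.keys e. f v ^ Poly_Mapping.lookup e v))"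
  unfolding mp_subst_def using assms
  by (intro sum.mono_neutral_left) (auto simp: in_keys_iff mp_const_arith)

lemma mp_subst_0: "mp_subst f 0 = 0"
  by (simp add: mp_subst_def)

lemma mp_subst_add: "mp_subst f (p + q) = mp_subst f p + mp_subst f q"
proof -
  let ?E = "Poly_Mapping.keys p \<union> Poly_Mapping.keys q"
  have "Poly_Mapping.keys (p + q) \<subseteq> ?E" by (rule Poly_Mapping.keys_add)
  then show ?thesis
    by (simp add: mp_subst_superset[of ?E] lookup_add mp_const_arith algebra_simps sum.distrib)
qed

lemma mp_subst_sum: "mp_subst f (sum g X) = (\<Sum>x\<in>X. mp_subst f (g x))"
  by (induction X rule: infinite_finite_induct) (simp_all add: mp_subst_0 mp_subst_add)

lemma mp_subst_single:
  "mp_subst f (Poly_Mapping.single e c) =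
    mp_const c * (\<Prod>v \<in> Poly_Mapping.keys e. f v ^ Poly_Mapping.lookup e v)"
  by (subst mp_subst_superset[of "{e}"]) auto

lemma prod_exponents_add:
  fixes f :: "'v \<Rightarrow> 'a::comm_semiring_1"
  shows "(\<Prod>v \<in> Poly_Mapping.keys (d + e). f v ^ Poly_Mapping.lookup (d + e) v) =
    (\<Prod>v \<in> Poly_Mapping.keys d. f v ^ Poly_Mapping.lookup d v) *
    (\<Prod>v \<in> Poly_Mapping.keys e. f v ^ Poly_Mapping.lookup e v)"
proof -
  let ?E = "Poly_Mapping.keys d \<union> Poly_Mapping.keys e"
  have *: "(\<Prod>v \<in> Poly_Mapping.keys g. f v ^ Poly_Mapping.lookup g v) =
      (\<Prod>v \<in> ?E. f v ^ Poly_Mapping.lookup g v)" if "Poly_Mapping.keys g \<subseteq> ?E" for g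
    using that by (intro prod.mono_neutral_left) (auto simp: in_keys_iff)
  show ?thesis
    by (subst (1 2 3) *) (auto simp: Poly_Mapping.keys_add lookup_add power_add prod.distrib)
qed

lemma mp_subst_mult:
  fixes f :: "'v \<Rightarrow> ('w, 'k::comm_ring_1) mpoly"
  shows "mp_subst f (p * q) = mp_subst f p * mp_subst f q"
proof -
  have sum_form: "h = (\<Sum>e\<in>Poly_Mapping.keys h. Poly_Mapping.single e (Poly_Mapping.lookup h e))"
    for h :: "('v, 'k) mpoly"
    by (rule poly_mapping_eqI)
      (auto simp: lookup_sum lookup_single when_def in_keys_iff sum.delta)
  have "mp_subst f (p * q) =
    mp_subst f ((\<Sum>d\<in>Poly_Mapping.keys p. Poly_Mapping.single d (Poly_Mapping.lookup p d)) *
      (\<Sum>e\<in>Poly_Mapping.keys q. Poly_Mapping.single e (Poly_Mapping.lookup q e)))"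
    by (simp only: sum_form[symmetric])
  also have "\<dots> = mp_subst f p * mp_subst f q"
    unfolding sum_product mult_single mp_subst_sum mp_subst_single prod_exponents_add
        mp_const_arith mp_subst_def[of f p] mp_subst_def[of f q]
    by (intro sum.cong refl) (simp only: ac_simps)
  finally show ?thesis .
qed

lemma mp_subst_const: "mp_subst f (mp_const c) = mp_const c"
  by (subst mp_const_def) (simp add: mp_subst_single)

lemma mp_subst_var: "mp_subst f (mp_var v) = f v"
  by (simp add: mp_var_def mp_subst_single mp_const_arith)

lemma psi_var_closed: "psi_var n q m A \<in> carrier (mpoly_ring {1..n})"
proof -
  have *: "(\<Prod>k\<in>F. mp_var k) \<in> carrier (mpoly_ring V)" if "F \<subseteq> V" for F V :: "nat set"
    using that by (induction F rule: infinite_finite_induct) (simp_all add: mpoly_ring_closed)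
  then show ?thesis
    unfolding psi_var_def by (intro *) auto
qed

lemma psi_closed: "psi n q m p \<in> carrier (mpoly_ring {1..n})"
proof -
  have prod: "(\<Prod>x\<in>X. g x) \<in> carrier (mpoly_ring {1..n})"
    if "\<And>x. x \<in> X \<Longrightarrow> g x \<in> carrier (mpoly_ring {1..n})" for X :: "nat set set" and g
    using that by (induction X rule: infinite_finite_induct) (simp_all add: mpoly_ring_closed)
  have sum: "(\<Sum>x\<in>X. g x) \<in> carrier (mpoly_ring {1..n})"
    if "\<And>x. x \<in> X \<Longrightarrow> g x \<in> carrier (mpoly_ring {1..n})" for X :: "(nat set \<Rightarrow>\<^sub>0 nat) set" and g
    using that by (induction X rule: infinite_finite_induct) (simp_all add: mpoly_ring_closed)
  have power: "p ^ d \<in> carrier (mpoly_ring {1..n})" if "p \<in> carrier (mpoly_ring {1..n})" for p d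
    using that by (induction d) (simp_all add: mpoly_ring_closed)
  show ?thesis
    unfolding psi_def mp_subst_def
    by (intro sum mpoly_ring_closed prod power psi_var_closed)
qed

lemma psi_ring_hom: "psi n q m \<in> ring_hom (extremal_ring q) (mpoly_ring {1..n})"
proof -
  have "mp_subst (psi_var n q m) 1 = 1"
    using mp_subst_const[of "psi_var n q m" 1] by (simp add: mp_const_arith)
  then show ?thesis
    using psi_closed[of n q m]
    by (intro ring_hom_memI)
      (simp_all add: extremal_ring_def psi_def mp_subst_mult mp_subst_add)
qed

end

theory Submission
  imports Defs "Jordan_Normal_Form.Determinant"
begin

text \<open>
  Everything is translated into integer arithmetic with the supports \<open>F j\<close> of the generators.
  A monomial with exponent vector \<open>b\<close> lies in \<open>I\<^sup>r\<close> iff some natural weights \<open>a\<close> on the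
  generators have total \<open>r\<close> and load every variable \<open>v\<close> by at most \<open>b v\<close>, the load being the sum
  of \<open>a j\<close> over the \<open>j\<close> with \<open>v \<in> F j\<close> (\<open>covers\<close>). It lies in the integral closure iff this
  holds with rational weights, that is, iff \<open>N b\<close> is covered at level \<open>N r\<close> for some \<open>N \<ge> 1\<close>
  (\<open>frac_covers\<close>). Both ideals are spanned by monomials (\<open>I_power_eq_covers\<close>,
  \<open>integral_closure_power_eq\<close>).

  The second description needs two arguments. If \<open>b\<close> is not fractionally covered, linear
  programming duality gives a weight on the variables under which \<open>b\<close> is lighter than everything
  in \<open>I\<^sup>r\<close>; then the part of least weight of an integral polynomial containing \<open>b\<close>, raised to
  the \<open>d\<close>-th power, cannot cancel in an equation of degree \<open>d\<close>. Conversely, multiplication by a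
  polynomial with fractionally covered monomials maps the ideal \<open>W\<close> of monomials that are
  fractionally covered at level \<open>q\<close> into \<open>I\<^sup>r W\<close>, because a rational vector of total \<open>r + q\<close> on
  \<open>q\<close> generators has integer parts of total at least \<open>r\<close>; the determinant trick turns this
  into an integral equation.

  Hence \<open>I\<^sup>r\<close> is integrally closed iff every fractional cover of level \<open>r\<close> can be rounded to an
  integral one (\<open>power_integrally_closed_iff\<close>). Splitting off integer parts leaves weights in
  \<open>[0, 1)\<close>, whose total \<open>\<rho>\<close> is less than \<open>q\<close>. For \<open>\<rho> = 0\<close>, \<open>1\<close> and \<open>q - 1\<close> rounding is always
  possible, so only \<open>2 \<le> \<rho> \<le> q - 2\<close> matters (\<open>covers_if_frac_covers\<close>). There is no such \<open>\<rho>\<close> for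
  \<open>q \<le> 3\<close>, only \<open>2\<close> for \<open>q = 4\<close>, and only \<open>2\<close> and \<open>3\<close> for \<open>q = 5\<close>. For \<open>q = 4\<close> the only obstruction
  is the vector with all weights \<open>1/2\<close>, which can be rounded exactly when some pair \<open>{a, b}\<close> is not
  the exact set of generators divisible by some variable, that is, when \<open>gcd (m a) (m b)\<close> divides
  \<open>lcm (m c) (m d)\<close>.

  The load of a variable depends only on its type, the set of generators that it divides. The
  extremal ideal has exactly one variable of each nonempty type, and \<open>\<psi>\<close> copies exponents from
  types to variables. Rounding a fractional cover up to its ceiling at each type therefore gives a
  monomial of the extremal ring whose image divides the given monomial, which proves the formula
  for the integral closure. The monomial \<open>g\<close> is fractionally covered by weights \<open>1/2\<close> on four
  generators together with \<open>r - 2\<close> copies of the first one.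
\<close>

section \<open>Integral and fractional covers\<close>

text \<open>
  The supports are kept as a family of sets and the exponents as functions, so that the
  combinatorics is independent of polynomials.
\<close>

definition load :: "(nat \<Rightarrow> 'v set) \<Rightarrow> nat \<Rightarrow> (nat \<Rightarrow> nat) \<Rightarrow> 'v \<Rightarrow> nat" where
  "load F q a v = (\<Sum>j \<in> {j \<in> {1..q}. v \<in> F j}. a j)"

definition covers :: "(nat \<Rightarrow> 'v set) \<Rightarrow> nat \<Rightarrow> nat \<Rightarrow> ('v \<Rightarrow> nat) \<Rightarrow> bool" where
  "covers F q r b \<longleftrightarrow> (\<exists>a. (\<Sum>j\<in>{1..q}. a j) = r \<and> (\<forall>v. load F q a v \<le> b v))"

text \<open>
  Rational weights with common denominator \<open>N\<close>, multiplied by \<open>N\<close>.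
\<close>

definition frac_covers :: "(nat \<Rightarrow> 'v set) \<Rightarrow> nat \<Rightarrow> nat \<Rightarrow> ('v \<Rightarrow> nat) \<Rightarrow> bool" where
  "frac_covers F q r b \<longleftrightarrow> (\<exists>N\<ge>1. covers F q (N * r) (\<lambda>v. N * b v))"

lemma load_add: "load F q (\<lambda>j. a j + c j) v = load F q a v + load F q c v"
  by (simp add: load_def sum.distrib)

lemma load_scale: "load F q (\<lambda>j. N * a j) v = N * load F q a v"
  by (simp add: load_def sum_distrib_left)

lemma load_le_total: "load F q a v \<le> (\<Sum>j\<in>{1..q}. a j)"
  unfolding load_def by (rule sum_mono2) auto

lemma le_load: "j \<in> {1..q} \<Longrightarrow> v \<in> F j \<Longrightarrow> a j \<le> load F q a v"
  unfolding load_def by (rule member_le_sum) auto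

lemma load_mono: "(\<And>j. j \<in> {1..q} \<Longrightarrow> a j \<le> c j) \<Longrightarrow> load F q a v \<le> load F q c v"
  unfolding load_def by (rule sum_mono) auto

lemma load_unit:
  assumes "j \<in> {1..q}"
  shows "load F q (\<lambda>i. if i = j then 1 else 0) v = of_bool (v \<in> F j)"
  using assms unfolding load_def by (subst sum.delta) auto

lemma sum_unit:
  fixes j q :: nat
  assumes "j \<in> {1..q}"
  shows "(\<Sum>i\<in>{1..q}. if i = j then 1 else 0) = (1::nat)"
  using assms by (subst sum.delta) auto

lemma coversI: "(\<Sum>j\<in>{1..q}. a j) = r \<Longrightarrow> (\<And>v. load F q a v \<le> b v) \<Longrightarrow> covers F q r b"
  unfolding covers_def by blast

lemma covers_mono: "covers F q r b \<Longrightarrow> (\<And>v. b v \<le> b' v) \<Longrightarrow> covers F q r b'"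
  unfolding covers_def using order_trans by blast

lemma covers_add:
  assumes "covers F q r b" "covers F q s c"
  shows "covers F q (r + s) (\<lambda>v. b v + c v)"
proof -
  obtain a a' where "(\<Sum>j\<in>{1..q}. a j) = r" "\<forall>v. load F q a v \<le> b v"
    "(\<Sum>j\<in>{1..q}. a' j) = s" "\<forall>v. load F q a' v \<le> c v"
    using assms unfolding covers_def by blast
  then show ?thesis
    by (intro coversI[where a = "\<lambda>j. a j + a' j"]) (auto simp: sum.distrib load_add add_mono)
qed

lemma covers_scale:
  assumes "covers F q r b"
  shows "covers F q (N * r) (\<lambda>v. N * b v)"
proof -
  obtain a where "(\<Sum>j\<in>{1..q}. a j) = r" "\<forall>v. load F q a v \<le> b v"
    using assms unfolding covers_def by blast
  then show ?thesis
    by (intro coversI[where a = "\<lambda>j. N * a j"]) (auto simp: sum_distrib_left[symmetric] load_scale)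
qed

lemma covers_imp_frac_covers: "covers F q r b \<Longrightarrow> frac_covers F q r b"
  unfolding frac_covers_def by (intro exI[of _ 1]) simp

lemma frac_covers_mono: "frac_covers F q r b \<Longrightarrow> (\<And>v. b v \<le> b' v) \<Longrightarrow> frac_covers F q r b'"
  unfolding frac_covers_def by (meson covers_mono mult_le_mono2)

lemma frac_covers_add:
  assumes "frac_covers F q r b" "frac_covers F q s c"
  shows "frac_covers F q (r + s) (\<lambda>v. b v + c v)"
proof -
  obtain N M where N: "N \<ge> 1" "covers F q (N * r) (\<lambda>v. N * b v)"
    and M: "M \<ge> 1" "covers F q (M * s) (\<lambda>v. M * c v)"
    using assms unfolding frac_covers_def by blast
  have "covers F q (M * (N * r) + N * (M * s)) (\<lambda>v. M * (N * b v) + N * (M * c v))"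
    by (intro covers_add covers_scale N M)
  then have "covers F q ((M * N) * (r + s)) (\<lambda>v. (M * N) * (b v + c v))"
    by (simp add: algebra_simps)
  moreover have "M * N \<ge> 1" using N(1) M(1) by simp
  ultimately show ?thesis unfolding frac_covers_def by blast
qed

lemma covers_1_iff: "covers F q 1 b \<longleftrightarrow> (\<exists>j\<in>{1..q}. \<forall>v\<in>F j. 1 \<le> b v)"
proof
  assume "covers F q 1 b"
  then obtain a where a: "(\<Sum>j\<in>{1..q}. a j) = 1" "\<And>v. load F q a v \<le> b v"
    unfolding covers_def by blast
  obtain j where j: "j \<in> {1..q}" "a j \<noteq> 0" using a(1) sum.neutral[of "{1..q}" a] by fastforce
  have "1 \<le> b v" if "v \<in> F j" for v
    using le_load[where F = F and a = a, OF j(1) that] a(2)[of v] j(2) by linarith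
  then show "\<exists>j\<in>{1..q}. \<forall>v\<in>F j. 1 \<le> b v" using j(1) by blast
next
  assume "\<exists>j\<in>{1..q}. \<forall>v\<in>F j. 1 \<le> b v"
  then obtain j where j: "j \<in> {1..q}" "\<And>v. v \<in> F j \<Longrightarrow> 1 \<le> b v" by blast
  show "covers F q 1 b"
  proof (rule coversI)
    show "(\<Sum>i\<in>{1..q}. if i = j then 1 else (0::nat)) = 1" using j(1) by (rule sum_unit)
    show "load F q (\<lambda>i. if i = j then 1 else 0) v \<le> b v" for v
      using j(2)[of v] unfolding load_unit[OF j(1)] by (simp add: of_bool_def)
  qed
qed

lemma covers_Suc_split:
  assumes "covers F q (Suc r) b"
  obtains j where "j \<in> {1..q}" "\<And>v. v \<in> F j \<Longrightarrow> 1 \<le> b v"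
    "covers F q r (\<lambda>v. b v - of_bool (v \<in> F j))"
proof -
  obtain a where a: "(\<Sum>j\<in>{1..q}. a j) = Suc r" "\<And>v. load F q a v \<le> b v"
    using assms unfolding covers_def by blast
  obtain j where j: "j \<in> {1..q}" "a j \<noteq> 0" using a(1) sum.neutral[of "{1..q}" a] by fastforce
  \<comment> \<open>one copy of the generator \<open>j\<close> is removed\<close>
  define a' where "a' i = a i - (if i = j then 1 else 0)" for i
  have aa': "a = (\<lambda>i. a' i + (if i = j then 1 else 0))" using j(2) unfolding a'_def by auto
  have "(\<Sum>i\<in>{1..q}. a i) = (\<Sum>i\<in>{1..q}. a' i) + 1"
    by (subst aa') (simp only: sum.distrib sum_unit[OF j(1)])
  then have "(\<Sum>i\<in>{1..q}. a' i) = r" using a(1) by simp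
  moreover have la: "load F q a v = load F q a' v + of_bool (v \<in> F j)" for v
    by (subst aa') (simp only: load_add load_unit[OF j(1)])
  moreover have "load F q a' v \<le> b v - of_bool (v \<in> F j)" for v
    using a(2)[of v] unfolding la by simp
  ultimately have "covers F q r (\<lambda>v. b v - of_bool (v \<in> F j))"
    by (intro coversI[where a = a'])
  moreover have "1 \<le> b v" if "v \<in> F j" for v using la[of v] a(2)[of v] that by simp
  ultimately show ?thesis using that j(1) by blast
qed

lemma bounded_subsum:
  fixes a :: "'i \<Rightarrow> nat"
  assumes "finite J" "r \<le> (\<Sum>j\<in>J. a j)"
  shows "\<exists>a'. (\<forall>j. a' j \<le> a j) \<and> (\<Sum>j\<in>J. a' j) = r"
  using assms
proof (induction J arbitrary: r rule: finite_induct)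
  case empty
  then show ?case by (intro exI[of _ "\<lambda>_. 0"]) simp
next
  case (insert i J)
  then have "r - min r (a i) \<le> (\<Sum>j\<in>J. a j)" by auto
  from insert.IH[OF this] obtain a' where a': "\<forall>j. a' j \<le> a j" "(\<Sum>j\<in>J. a' j) = r - min r (a i)"
    by blast
  moreover have "(\<Sum>j\<in>J. (a'(i := min r (a i))) j) = (\<Sum>j\<in>J. a' j)"
    using insert.hyps by (intro sum.cong) auto
  ultimately show ?case
    using insert.hyps by (intro exI[of _ "a'(i := min r (a i))"]) auto
qed

text \<open>
  With \<open>c/N\<close> of total \<open>r + q\<close> on \<open>q\<close> generators, the fractional parts sum to at most \<open>q\<close>, so the
  integer parts contain an integral cover of level \<open>r\<close>. This makes the fractionally covered
  monomials of level \<open>q\<close> a module that absorbs level \<open>r\<close> through \<open>I\<^sup>r\<close>.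
\<close>

lemma frac_covers_split:
  assumes "frac_covers F q (r + q) b"
  obtains a where "(\<Sum>j\<in>{1..q}. a j) = r" "\<And>v. load F q a v \<le> b v"
    "frac_covers F q q (\<lambda>v. b v - load F q a v)"
proof -
  obtain N c where N: "N \<ge> 1" and c: "(\<Sum>j\<in>{1..q}. c j) = N * (r + q)"
    "\<And>v. load F q c v \<le> N * b v"
    using assms unfolding frac_covers_def covers_def by blast
  have "c j \<le> N * (c j div N) + N" for j
  proof -
    have "c j mod N < N" using N by simp
    then show ?thesis using mult_div_mod_eq[of N "c j"] by linarith
  qed
  then have "N * (r + q) \<le> (\<Sum>j\<in>{1..q}. N * (c j div N) + N)"
    unfolding c(1)[symmetric] by (intro sum_mono) auto
  also have "\<dots> = N * ((\<Sum>j\<in>{1..q}. c j div N) + q)"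
    unfolding sum.distrib by (simp add: sum_distrib_left algebra_simps)
  finally have "r \<le> (\<Sum>j\<in>{1..q}. c j div N)" using N by simp
  then obtain a where a: "\<And>j. a j \<le> c j div N" "(\<Sum>j\<in>{1..q}. a j) = r"
    using bounded_subsum[of "{1..q}" r "\<lambda>j. c j div N"] by auto
  have Na: "N * a j \<le> c j" for j
    using mult_le_mono2[OF a(1), of N j] by (meson le_trans times_div_less_eq_dividend)
  have c_eq: "c = (\<lambda>j. N * a j + (c j - N * a j))" using Na by auto
  have split: "load F q c v = N * load F q a v + load F q (\<lambda>j. c j - N * a j) v" for v
    by (subst c_eq) (simp only: load_add load_scale)
  have le: "load F q a v \<le> b v" for v
  proof -
    have "N * load F q a v \<le> N * b v" using split[of v] c(2)[of v] by linarith
    then show ?thesis using N by simp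
  qed
  have "(\<Sum>j\<in>{1..q}. c j) = N * (\<Sum>j\<in>{1..q}. a j) + (\<Sum>j\<in>{1..q}. c j - N * a j)"
    by (subst c_eq) (simp only: sum.distrib sum_distrib_left)
  then have "(\<Sum>j\<in>{1..q}. c j - N * a j) = N * q"
    unfolding a(2) c(1) by (simp add: algebra_simps)
  moreover have "load F q (\<lambda>j. c j - N * a j) v \<le> N * (b v - load F q a v)" for v
    using split[of v] c(2)[of v] by (simp add: diff_mult_distrib2)
  ultimately have "covers F q (N * q) (\<lambda>v. N * (b v - load F q a v))"
    by (intro coversI)
  then have "frac_covers F q q (\<lambda>v. b v - load F q a v)"
    using N unfolding frac_covers_def by blast
  then show ?thesis using that a(2) le by blast
qed

section \<open>Rounding fractional covers\<close>

text \<open>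
  The rounding problem of total \<open>\<rho>\<close> for weights \<open>e/N\<close> that are all less than \<open>1\<close>.
\<close>

definition reduced_rounding :: "(nat \<Rightarrow> 'v set) \<Rightarrow> nat \<Rightarrow> nat \<Rightarrow> bool" where
  "reduced_rounding F q \<rho> \<longleftrightarrow> (\<forall>N e b. (\<forall>j\<in>{1..q}. e j < N) \<longrightarrow> N \<ge> 1 \<longrightarrow>
     (\<Sum>j\<in>{1..q}. e j) = N * \<rho> \<longrightarrow> (\<forall>v. load F q e v \<le> N * b v) \<longrightarrow> covers F q \<rho> b)"

lemma reduced_roundingD:
  assumes "reduced_rounding F q \<rho>" "\<And>j. e j < N" "N \<ge> 1" "(\<Sum>j\<in>{1..q}. e j) = N * \<rho>"
    "\<And>v. load F q e v \<le> N * b v"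
  shows "covers F q \<rho> b"
  using assms(1)[unfolded reduced_rounding_def, rule_format, of e N b] assms(2-5) by simp

lemma reduced_rounding_0: "reduced_rounding F q 0"
  unfolding reduced_rounding_def by (auto intro!: coversI[where a = "\<lambda>_. 0"] simp: load_def)

text \<open>
  Any single generator of positive weight will do, since it makes the load positive on its support.
\<close>

lemma reduced_rounding_1: "reduced_rounding F q 1"
  unfolding reduced_rounding_def
proof (intro allI impI)
  fix N :: nat and e :: "nat \<Rightarrow> nat" and b
  assume "N \<ge> 1" and sum: "(\<Sum>j\<in>{1..q}. e j) = N * 1"
    and le: "\<forall>v. load F q e v \<le> N * b v"
  then obtain j where j: "j \<in> {1..q}" "e j > 0"
    by (metis One_nat_def gr0I le_numeral_extra(2) mult.right_neutral sum.neutral)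
  have "b v \<ge> 1" if v: "v \<in> F j" for v
  proof -
    have "0 < N * b v"
      using le_load[where F = F and a = e, OF j(1) v] le j(2) by (meson le_trans less_le_trans)
    then show ?thesis by simp
  qed
  then show "covers F q 1 b"
    using j by (intro coversI[where a = "\<lambda>i. if i = j then 1 else 0"])
      (auto simp only: sum_unit load_unit of_bool_def split: if_split)
qed

text \<open>
  The complementary weights \<open>1 - e/N\<close> are positive with total \<open>1\<close>, so this is dual to the case of
  total \<open>1\<close>: taking every generator except one, here the first, works.
\<close>

lemma reduced_rounding_pred:
  assumes q: "q \<ge> 1"
  shows "reduced_rounding F q (q - 1)"
  unfolding reduced_rounding_def
proof (intro allI impI)
  fix N :: nat and e :: "nat \<Rightarrow> nat" and b
  assume e: "\<forall>j\<in>{1..q}. e j < N" and N: "N \<ge> 1"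
    and sum: "(\<Sum>j\<in>{1..q}. e j) = N * (q - 1)"
    and le: "\<forall>v. load F q e v \<le> N * b v"
  let ?a = "\<lambda>j. if j = 1 then 0 else (1::nat)"
  have tot: "(\<Sum>j\<in>{1..q}. ?a j) = q - 1"
  proof -
    have "(\<Sum>j\<in>{1..q}. ?a j) = (\<Sum>j\<in>{1..q} - {1}. 1)"
      by (intro sum.mono_neutral_cong_right) auto
    then show ?thesis using q by (simp add: card_Diff_subset)
  qed
  show "covers F q (q - 1) b"
  proof (rule coversI[OF tot])
    fix v
    define A where "A = {j \<in> {1..q}. v \<in> F j}"
    have fin: "finite A" and sub: "A \<subseteq> {1..q}" unfolding A_def by auto
    have la: "load F q ?a v = card (A - {1})"
    proof -
      have "load F q ?a v = (\<Sum>j\<in>A - {1}. 1)"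
        unfolding load_def A_def[symmetric] using fin by (intro sum.mono_neutral_cong_right) auto
      then show ?thesis by simp
    qed
    have split: "load F q e v + (\<Sum>j\<in>{1..q} - A. e j) = N * (q - 1)"
      unfolding load_def A_def[symmetric] sum[symmetric]
      using sum.subset_diff[OF sub, of e] by simp
    have card: "card A + card ({1..q} - A) = q"
      using sub fin by (simp add: card_Diff_subset card_mono[of "{1..q}" A, simplified])
    show "load F q ?a v \<le> b v"
    proof (cases "1 \<in> A")
      case True
      have "(\<Sum>j\<in>{1..q} - A. e j) \<le> N * card ({1..q} - A)"
        using e by (intro order_trans[OF sum_bounded_above[where K = N]]) (auto intro: less_imp_le)
      moreover have "q - 1 = card (A - {1}) + card ({1..q} - A)"
        using True fin card card_Suc_Diff1[of A 1] by simp
      ultimately have "N * card (A - {1}) \<le> load F q e v"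
        using split by (simp add: algebra_simps)
      then have "N * card (A - {1}) \<le> N * b v" using le le_trans by blast
      then show ?thesis using N la by simp
    next
      case False
      then have "{1..q} - A \<noteq> {}" using q by auto
      then have "(\<Sum>j\<in>{1..q} - A. e j) < N * card ({1..q} - A)"
        using e sum_strict_mono[of "{1..q} - A" e "\<lambda>_. N"] by (simp add: mult.commute)
      moreover have "N * (q - 1) + N = N * card A + N * card ({1..q} - A)"
        using card q by (metis add.commute distrib_left le_add_diff_inverse mult.right_neutral)
      ultimately have "N * card A < load F q e v + N"
        using split by linarith
      then have "N * card A < N * (b v + 1)" using le[rule_format, of v] by simp
      then have "card A < b v + 1" unfolding mult_less_cancel1 by simp
      then show ?thesis using la False by simp
    qed
  qed
qed

text \<open>
  Splitting off the integer parts of the weights reduces the level \<open>r\<close> to a remainder \<open>\<rho> < q\<close>, and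
  the remainders \<open>0\<close>, \<open>1\<close> and \<open>q - 1\<close> never obstruct.
\<close>

theorem covers_if_frac_covers:
  assumes q: "q \<ge> 1"
    and mid: "\<And>\<rho>. 2 \<le> \<rho> \<Longrightarrow> \<rho> + 2 \<le> q \<Longrightarrow> reduced_rounding F q \<rho>"
    and frac: "frac_covers F q r b"
  shows "covers F q r b"
proof -
  obtain N a where N: "N \<ge> 1" and tot: "(\<Sum>j\<in>{1..q}. a j) = N * r"
    and le: "\<And>v. load F q a v \<le> N * b v"
    using frac unfolding frac_covers_def covers_def by blast
  \<comment> \<open>\<open>d\<close> are the integer parts and \<open>e / N\<close> the fractional parts of the weights \<open>a / N\<close>\<close>
  define d where "d = (\<lambda>j. a j div N)"
  define e where "e = (\<lambda>j. a j mod N)"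
  define D where "D = (\<Sum>j\<in>{1..q}. d j)"
  have a: "a = (\<lambda>j. N * d j + e j)" unfolding d_def e_def by auto
  have e: "e j < N" for j using N by (simp add: e_def)
  have sum: "N * D + (\<Sum>j\<in>{1..q}. e j) = N * r"
    using tot unfolding a D_def by (simp add: sum.distrib sum_distrib_left)
  have D: "D \<le> r"
  proof -
    have "N * D \<le> N * r" using sum by linarith
    then show ?thesis using N by simp
  qed
  have sum_e: "(\<Sum>j\<in>{1..q}. e j) = N * (r - D)"
    using sum by (simp add: diff_mult_distrib2)
  have "(\<Sum>j\<in>{1..q}. e j) < (\<Sum>j\<in>{1..q}. N)"
    using e q by (intro sum_strict_mono) auto
  then have "N * (r - D) < N * q" using sum_e by (simp add: mult.commute)
  then have small: "r - D < q" by simp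
  have le': "N * load F q d v + load F q e v \<le> N * b v" for v
    using le[of v] unfolding a load_add load_scale .
  have d_le: "load F q d v \<le> b v" for v
  proof -
    have "N * load F q d v \<le> N * b v" using le'[of v] by linarith
    then show ?thesis using N by simp
  qed
  have "reduced_rounding F q (r - D)"
  proof -
    consider "r - D = 0" | "r - D = 1" | "r - D = q - 1" | "2 \<le> r - D" "r - D + 2 \<le> q"
      using small by linarith
    then show ?thesis
    proof cases
      case 1
      show ?thesis unfolding 1 by (rule reduced_rounding_0)
    next
      case 2
      show ?thesis unfolding 2 by (rule reduced_rounding_1)
    next
      case 3
      show ?thesis unfolding 3 by (rule reduced_rounding_pred[OF q])
    next
      case 4
      then show ?thesis by (rule mid)
    qed
  qed
  moreover have "load F q e v \<le> N * (b v - load F q d v)" for v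
    using le'[of v] by (simp add: diff_mult_distrib2)
  ultimately have "covers F q (r - D) (\<lambda>v. b v - load F q d v)"
    by (intro reduced_roundingD[where N = N and e = e] e N sum_e)
  moreover have "covers F q D (load F q d)"
    unfolding D_def by (rule coversI) auto
  ultimately have "covers F q (r - D + D) (\<lambda>v. b v - load F q d v + load F q d v)"
    by (rule covers_add)
  then show ?thesis using D d_le by simp
qed

lemma reduced_rounding_if_frac:
  assumes "\<And>b. frac_covers F q \<rho> b \<Longrightarrow> covers F q \<rho> b"
  shows "reduced_rounding F q \<rho>"
  using assms unfolding reduced_rounding_def frac_covers_def covers_def by blast

lemma covers_pair:
  assumes ij: "i \<in> {1..q}" "j \<in> {1..q}"
    and v: "\<And>v. of_bool (v \<in> F i) + of_bool (v \<in> F j) \<le> b v"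
  shows "covers F q 2 b"
proof -
  have "covers F q 1 (\<lambda>v. of_bool (v \<in> F i))" if "i \<in> {1..q}" for i
    using that
    by (intro coversI[where a = "\<lambda>j. if j = i then 1 else 0"]) (simp_all only: sum_unit load_unit order_refl)
  from covers_add[OF this[OF ij(1)] this[OF ij(2)]]
  have "covers F q 2 (\<lambda>v. of_bool (v \<in> F i) + of_bool (v \<in> F j))"
    by (simp add: numeral_2_eq_2)
  then show ?thesis using v by (rule covers_mono)
qed

lemma load_ge_pair:
  assumes "i \<in> {1..q}" "j \<in> {1..q}" "i \<noteq> j" "v \<in> F i" "v \<in> F j"
  shows "e i + e j \<le> load F q e v"
proof -
  have "(\<Sum>l\<in>{i, j}. e l) \<le> load F q e v"
    unfolding load_def using assms by (intro sum_mono2) auto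
  then show ?thesis using assms(3) by simp
qed

lemma load_ge_triple:
  assumes "i \<in> {1..q}" "j \<in> {1..q}" "l \<in> {1..q}" "i \<noteq> j" "i \<noteq> l" "j \<noteq> l"
    "v \<in> F i" "v \<in> F j" "v \<in> F l"
  shows "e i + e j + e l \<le> load F q e v"
proof -
  have "(\<Sum>l\<in>{i, j, l}. e l) \<le> load F q e v"
    unfolding load_def using assms by (intro sum_mono2) auto
  then show ?thesis using assms(4-6) by simp
qed

text \<open>
  Two generators of positive weight form a cover unless a variable in both supports has load at
  most \<open>1\<close>. So a pair with weights of total more than \<open>1\<close> works. Complementary pairs have
  total \<open>2\<close>, so otherwise every pair has total \<open>1\<close> and all weights are \<open>1/2\<close>. Then \<open>{a, b}\<close>
  works: each variable in both supports lies in a third one and has load at least \<open>3/2\<close>.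
\<close>

lemma reduced_rounding_4_2:
  fixes F :: "nat \<Rightarrow> 'v set"
  assumes abcd: "{a, b, c, d} = {1, 2, 3, 4::nat}"
    and miss: "F a \<inter> F b \<subseteq> F c \<union> F d"
  shows "reduced_rounding F 4 2"
  unfolding reduced_rounding_def
proof (intro allI impI)
  fix N :: nat and e :: "nat \<Rightarrow> nat" and w :: "'v \<Rightarrow> nat"
  assume e: "\<forall>j\<in>{1..4}. e j < N" and N: "N \<ge> 1"
    and sum: "(\<Sum>j\<in>{1..4}. e j) = N * 2"
    and le: "\<forall>v. load F 4 e v \<le> N * w v"
  have set4: "{1..4} = {1, 2, 3, 4::nat}" by auto
  have dist: "a \<noteq> b" "a \<noteq> c" "a \<noteq> d" "b \<noteq> c" "b \<noteq> d" "c \<noteq> d"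
  proof -
    have "card {a, b, c, d} = 4" unfolding abcd by simp
    then show "a \<noteq> b" "a \<noteq> c" "a \<noteq> d" "b \<noteq> c" "b \<noteq> d" "c \<noteq> d"
      by (auto simp: card_insert_if split: if_splits)
  qed
  have mem: "a \<in> {1..4}" "b \<in> {1..4}" "c \<in> {1..4}" "d \<in> {1..4}"
    unfolding set4 abcd[symmetric] by auto
  have sum4: "e a + e b + e c + e d = 2 * N"
    using sum dist unfolding set4 abcd[symmetric] by simp
  have less: "e a < N" "e b < N" "e c < N" "e d < N" using e mem by auto
  have one: "w v \<ge> 1" if "i \<in> {1..4}" "v \<in> F i" "e i > 0" for i v
  proof -
    have "0 < N * w v"
      using le_load[where F = F and a = e, OF that(1,2)] le that(3) by (meson le_trans less_le_trans)
    then show ?thesis by simp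
  qed
  have two: "w v \<ge> 2" if "N < load F 4 e v" for v
  proof -
    have "N * 1 < N * w v" using that le[rule_format, of v] by linarith
    then have "1 < w v" unfolding mult_less_cancel1 by simp
    then show ?thesis by simp
  qed
  have pair: "covers F 4 2 w"
    if ij: "i \<in> {1..4}" "j \<in> {1..4}" "e i > 0" "e j > 0"
      and both: "\<And>v. v \<in> F i \<Longrightarrow> v \<in> F j \<Longrightarrow> N < load F 4 e v" for i j
    using one[OF ij(1) _ ij(3)] one[OF ij(2) _ ij(4)] two[OF both]
    by (intro covers_pair[OF ij(1,2)]) (auto simp: of_bool_def numeral_2_eq_2)
  show "covers F 4 2 w"
  proof (cases "\<exists>i\<in>{1..4}. \<exists>j\<in>{1..4}. i \<noteq> j \<and> N < e i + e j")
    case True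
    then obtain i j where ij: "i \<in> {1..4}" "j \<in> {1..4}" "i \<noteq> j" "N < e i + e j" by blast
    have "e i > 0" "e j > 0" using e ij by fastforce+
    then show ?thesis
      using load_ge_pair[OF ij(1-3), of _ F e] ij by (intro pair[of i j]) (auto intro: less_le_trans)
  next
    case False
    have "e i + e j \<le> N" if "i \<in> {1..4}" "j \<in> {1..4}" "i \<noteq> j" for i j
      using False that by (meson not_le)
    from this[OF mem(1) mem(2) dist(1)] this[OF mem(3) mem(4) dist(6)]
      this[OF mem(1) mem(3) dist(2)] this[OF mem(2) mem(4) dist(5)]
      this[OF mem(1) mem(4) dist(3)] this[OF mem(2) mem(3) dist(4)] sum4
    have half: "2 * e a = N" "2 * e b = N" "2 * e c = N" "2 * e d = N" by linarith+
    show ?thesis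
    proof (rule pair[of a b])
      fix v assume v: "v \<in> F a" "v \<in> F b"
      then consider "v \<in> F c" | "v \<in> F d" using miss by blast
      then show "N < load F 4 e v"
      proof cases
        case 1
        show ?thesis
          using load_ge_triple[of a 4 b c v F e] mem dist v 1 half N by fastforce
      next
        case 2
        show ?thesis
          using load_ge_triple[of a 4 b d v F e] mem dist v 2 half N by fastforce
      qed
    qed (use mem half N in auto)
  qed
qed

text \<open>
  The converse obstruction: the weights \<open>1/2\<close> on all four generators give load \<open>1\<close> to a variable
  whose type is a pair. If every pair occurs as a type, an integral cover of level \<open>2\<close>
  would have total at most \<open>1\<close> on every pair, which four natural numbers of total \<open>2\<close> cannot have.
\<close>

lemma rounding_imp_pair_missing:
  fixes F :: "nat \<Rightarrow> 'v set"
  assumes closed: "\<And>b. frac_covers F 4 2 b \<Longrightarrow> covers F 4 2 b"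
  shows "\<exists>a b c d. {a, b, c, d} = {1, 2, 3, 4} \<and> F a \<inter> F b \<subseteq> F c \<union> F d"
proof (rule ccontr)
  assume none: "\<not> (\<exists>a b c d. {a, b, c, d} = {1, 2, 3, 4} \<and> F a \<inter> F b \<subseteq> F c \<union> F d)"
  have set4: "{1..4} = {1, 2, 3, 4::nat}" by auto
  define T where "T v = {j \<in> {1..4}. v \<in> F j}" for v
  \<comment> \<open>the ceiling of the load \<open>card (T v) / 2\<close> under the weights \<open>1/2\<close>\<close>
  define b where "b v = (card (T v) + 1) div 2" for v
  have "frac_covers F 4 2 b"
    unfolding frac_covers_def
  proof (intro exI[of _ 2] conjI coversI)
    show "(\<Sum>j\<in>{1..4::nat}. 1) = 2 * (2::nat)" by simp
    show "load F 4 (\<lambda>_. 1) v \<le> 2 * b v" for v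
      unfolding load_def b_def T_def[symmetric] by simp
  qed simp
  then obtain a where sum: "(\<Sum>j\<in>{1..4}. a j) = 2" and le: "\<And>v. load F 4 a v \<le> b v"
    using closed unfolding covers_def by blast
  have few: "a i + a j \<le> 1" if ij: "{i, j, k, l} = {1, 2, 3, 4}" for i j k l
  proof -
    have dist: "i \<noteq> j"
    proof
      assume "i = j"
      then have "card {i, j, k, l} \<le> 3" by (simp add: card_insert_if)
      then show False unfolding ij by simp
    qed
    have "\<not> F i \<inter> F j \<subseteq> F k \<union> F l"
    proof
      assume "F i \<inter> F j \<subseteq> F k \<union> F l"
      with ij have "\<exists>a b c d. {a, b, c, d} = {1, 2, 3, 4} \<and> F a \<inter> F b \<subseteq> F c \<union> F d"
        by (intro exI conjI)
      with none show False by (rule notE)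
    qed
    then obtain v where v: "v \<in> F i" "v \<in> F j" "v \<notin> F k" "v \<notin> F l" by blast
    have "T v = {x \<in> {i, j, k, l}. v \<in> F x}" unfolding T_def set4 ij ..
    then have "T v = {i, j}" using v by auto
    then have "load F 4 a v = a i + a j" "b v = 1"
      using dist unfolding load_def b_def T_def[symmetric] by simp_all
    then show ?thesis using le[of v] by simp
  qed
  have "a 1 + a 2 \<le> 1" "a 3 + a 4 \<le> 1" "a 1 + a 3 \<le> 1" "a 2 + a 4 \<le> 1" "a 1 + a 4 \<le> 1" "a 2 + a 3 \<le> 1"
    using few[of 1 2 3 4] few[of 3 4 1 2] few[of 1 3 2 4] few[of 2 4 1 3] few[of 1 4 2 3] few[of 2 3 1 4]
    by (simp_all add: insert_commute)
  moreover have "a 1 + a 2 + a 3 + a 4 = 2" using sum unfolding set4 by simp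
  ultimately show False by (cases "a 1 = 0") linarith+
qed

section \<open>Linear inequalities and separating weights\<close>

text \<open>
  A pair \<open>(g, h)\<close> stands for the inequality \<open>(\<Sum>i. g i * x i) \<le> h\<close>; the cone consists of the
  inequalities that follow from \<open>K\<close> by nonnegative linear combination.
\<close>

inductive_set cone :: "(('i \<Rightarrow> 'a::linordered_field) \<times> 'a) set \<Rightarrow> (('i \<Rightarrow> 'a) \<times> 'a) set"
  for K where
  gen: "\<kappa> \<in> K \<Longrightarrow> \<kappa> \<in> cone K"
| add: "(g, h) \<in> cone K \<Longrightarrow> (g', h') \<in> cone K \<Longrightarrow> (\<lambda>i. g i + g' i, h + h') \<in> cone K"
| scale: "(g, h) \<in> cone K \<Longrightarrow> t \<ge> 0 \<Longrightarrow> (\<lambda>i. t * g i, t * h) \<in> cone K"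

lemma cone_least:
  assumes "\<kappa> \<in> cone K'" "K' \<subseteq> cone K"
  shows "\<kappa> \<in> cone K"
  using assms(1)
proof induction
  case (gen \<kappa>)
  then show ?case using assms(2) by blast
next
  case (add g h g' h')
  show ?case by (rule cone.add) (fact add.IH)+
next
  case (scale g h t)
  show ?case by (rule cone.scale) (fact scale.IH scale.hyps)+
qed

lemma cone_coeff_0:
  assumes "\<kappa> \<in> cone K" "\<And>\<kappa>. \<kappa> \<in> K \<Longrightarrow> fst \<kappa> j = 0"
  shows "fst \<kappa> j = 0"
  using assms(1) by induction (simp_all add: assms(2))

lemma between_finite_sets:
  fixes A B :: "'a::linorder set"
  assumes "finite A" "finite B" "\<And>a b. a \<in> A \<Longrightarrow> b \<in> B \<Longrightarrow> a \<le> b"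
  obtains t where "\<And>a. a \<in> A \<Longrightarrow> a \<le> t" "\<And>b. b \<in> B \<Longrightarrow> t \<le> b"
proof (cases "A = {}")
  case True
  show ?thesis
  proof (cases "B = {}")
    case True with \<open>A = {}\<close> show ?thesis using that by blast
  next
    case False with \<open>A = {}\<close> show ?thesis using assms by (intro that[of "Min B"]) simp_all
  qed
next
  case False then show ?thesis using assms by (intro that[of "Max A"]) simp_all
qed

text \<open>
  Fourier-Motzkin elimination: to remove \<open>x j\<close>, combine each inequality bounding it from above with
  each one bounding it from below. A solution of the resulting system leaves a nonempty interval
  for \<open>x j\<close>. Working over an arbitrary ordered field gives rational solutions of rational systems.
\<close>

lemma farkas:
  fixes K :: "(('i \<Rightarrow> 'a::linordered_field) \<times> 'a) set"
  assumes "finite J" "finite K"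
    and "\<And>\<kappa>. \<kappa> \<in> cone K \<Longrightarrow> (\<forall>j\<in>J. fst \<kappa> j = 0) \<Longrightarrow> 0 \<le> snd \<kappa>"
  shows "\<exists>x. \<forall>\<kappa>\<in>K. (\<Sum>j\<in>J. fst \<kappa> j * x j) \<le> snd \<kappa>"
  using assms
proof (induction J arbitrary: K rule: finite_induct)
  case empty
  then show ?case using cone.gen by fastforce
next
  case (insert j J)
  define Z where "Z = {\<kappa> \<in> K. fst \<kappa> j = 0}"
  define P where "P = {\<kappa> \<in> K. fst \<kappa> j > 0}"
  define M where "M = {\<kappa> \<in> K. fst \<kappa> j < 0}"
  define elim where "elim \<kappa> \<mu> =
    (\<lambda>i. fst \<kappa> j * fst \<mu> i + (- fst \<mu> j) * fst \<kappa> i, fst \<kappa> j * snd \<mu> + (- fst \<mu> j) * snd \<kappa>)"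
    for \<kappa> \<mu> :: "('i \<Rightarrow> 'a) \<times> 'a"
  define K' where "K' = Z \<union> case_prod elim ` (P \<times> M)"
  have "elim \<kappa> \<mu> \<in> cone K" if "\<kappa> \<in> P" "\<mu> \<in> M" for \<kappa> \<mu>
    using that unfolding elim_def P_def M_def
    by (intro cone.add cone.scale) (auto intro: cone.gen)
  then have K'_cone: "K' \<subseteq> cone K"
    unfolding K'_def Z_def by (auto intro: cone.gen)
  have K'_j: "fst \<kappa> j = 0" if "\<kappa> \<in> K'" for \<kappa>
    using that unfolding K'_def Z_def elim_def by (auto simp: algebra_simps)
  have "finite K'" unfolding K'_def Z_def P_def M_def using insert.prems(1) by auto
  moreover have "0 \<le> snd \<kappa>" if "\<kappa> \<in> cone K'" "\<forall>i\<in>J. fst \<kappa> i = 0" for \<kappa>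
    using insert.prems(2)[OF cone_least[OF that(1) K'_cone]] that(2) cone_coeff_0[OF that(1) K'_j]
    by simp
  ultimately obtain x where x: "\<And>\<kappa>. \<kappa> \<in> K' \<Longrightarrow> (\<Sum>i\<in>J. fst \<kappa> i * x i) \<le> snd \<kappa>"
    using insert.IH[of K'] by blast
  \<comment> \<open>the bound that an inequality puts on the eliminated variable, given the values of the others\<close>
  define slack where "slack = (\<lambda>\<kappa>. (snd \<kappa> - (\<Sum>i\<in>J. fst \<kappa> i * x i)) / fst \<kappa> j)"
  have "slack \<mu> \<le> slack \<kappa>" if \<kappa>: "\<kappa> \<in> P" and \<mu>: "\<mu> \<in> M" for \<kappa> \<mu>
  proof -
    define s where "s \<nu> = (\<Sum>i\<in>J. fst \<nu> i * x i)" for \<nu> :: "('i \<Rightarrow> 'a) \<times> 'a"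
    have "elim \<kappa> \<mu> \<in> K'" using \<kappa> \<mu> unfolding K'_def by blast
    from x[OF this] have "s (elim \<kappa> \<mu>) \<le> fst \<kappa> j * snd \<mu> - fst \<mu> j * snd \<kappa>"
      unfolding s_def by (simp add: elim_def)
    moreover have "s (elim \<kappa> \<mu>) = fst \<kappa> j * s \<mu> - fst \<mu> j * s \<kappa>"
      unfolding s_def elim_def by (simp add: distrib_right sum.distrib sum_distrib_left mult.assoc left_diff_distrib sum_subtractf)
    ultimately have "(snd \<kappa> - s \<kappa>) * fst \<mu> j \<le> (snd \<mu> - s \<mu>) * fst \<kappa> j"
      by (simp add: algebra_simps)
    moreover have "fst \<kappa> j > 0" "fst \<mu> j < 0" using \<kappa> \<mu> unfolding P_def M_def by auto
    ultimately show ?thesis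
      unfolding slack_def s_def[symmetric] by (simp add: neg_divide_le_eq pos_divide_le_eq)
  qed
  moreover have "finite P" "finite M" unfolding P_def M_def using insert.prems(1) by auto
  ultimately obtain t where t': "\<And>u. u \<in> slack ` M \<Longrightarrow> u \<le> t" "\<And>u. u \<in> slack ` P \<Longrightarrow> t \<le> u"
    by (elim between_finite_sets[of "slack ` M" "slack ` P", rotated -1]) auto
  have t: "\<And>\<mu>. \<mu> \<in> M \<Longrightarrow> slack \<mu> \<le> t" "\<And>\<kappa>. \<kappa> \<in> P \<Longrightarrow> t \<le> slack \<kappa>"
    using t' by auto
  define y where "y = x(j := t)"
  have y: "(\<Sum>i\<in>insert j J. fst \<kappa> i * y i) = fst \<kappa> j * t + (\<Sum>i\<in>J. fst \<kappa> i * x i)" for \<kappa>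
    using insert.hyps unfolding y_def by (simp, intro sum.cong) auto
  have "(\<Sum>i\<in>insert j J. fst \<kappa> i * y i) \<le> snd \<kappa>" if "\<kappa> \<in> K" for \<kappa>
  proof -
    consider "\<kappa> \<in> Z" | "\<kappa> \<in> P" | "\<kappa> \<in> M" using \<open>\<kappa> \<in> K\<close> unfolding Z_def P_def M_def by force
    then show ?thesis
    proof cases
      case 1
      then show ?thesis using x[of \<kappa>] unfolding y K'_def Z_def by auto
    next
      case 2
      then show ?thesis using t(2)[OF 2] unfolding y slack_def P_def by (simp add: pos_le_divide_eq algebra_simps)
    next
      case 3
      then show ?thesis using t(1)[OF 3] unfolding y slack_def M_def by (simp add: neg_divide_le_eq algebra_simps)
    qed
  qed
  then show ?case by blast
qed

lemma common_denominator:
  fixes x :: "'i \<Rightarrow> rat"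
  assumes "finite J" "\<And>j. j \<in> J \<Longrightarrow> x j \<ge> 0"
  obtains N :: nat and a :: "'i \<Rightarrow> nat" where "N \<ge> 1" "\<And>j. j \<in> J \<Longrightarrow> of_nat N * x j = of_nat (a j)"
proof -
  have "\<exists>N\<ge>1::nat. \<exists>a. \<forall>j\<in>J. of_nat N * x j = of_nat (a j)"
    using assms
  proof (induction J rule: finite_induct)
    case empty
    then show ?case by (intro exI[of _ 1]) simp
  next
    case (insert i J)
    then obtain N a where N: "N \<ge> 1" "\<forall>j\<in>J. of_nat N * x j = of_nat (a j)" by auto
    obtain p d where pd: "x i = Rat.Fract p d" "d > 0" by (cases "x i") auto
    have "p \<ge> 0" using insert.prems[of i] pd by (simp add: Rat.zero_le_Fract_iff)
    define b where "b j = (if j = i then N * nat p else nat d * a j)" for j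
    have "of_nat (N * nat d) * x j = of_nat (b j)" if "j \<in> insert i J" for j
    proof (cases "j = i")
      case True
      have "of_int d * x i = of_int p" unfolding pd Rat.Fract_of_int_quotient using pd(2) by simp
      then show ?thesis
        using True pd(2) \<open>p \<ge> 0\<close> unfolding b_def by (simp add: of_nat_nat mult.assoc)
    next
      case False
      then have "of_nat N * x j = of_nat (a j)" using N(2) that by auto
      then show ?thesis using False unfolding b_def by (simp add: algebra_simps)
    qed
    moreover have "N * nat d \<ge> 1" using N(1) pd(2) by (simp add: Suc_le_eq)
    ultimately show ?case by blast
  qed
  then show ?thesis using that by blast
qed

text \<open>
  Duality for the system asking that \<open>x \<ge> 0\<close> have total at least \<open>r\<close> and load at most \<open>b\<close>. A
  rational solution becomes a fractional cover after clearing denominators and discarding the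
  excess over \<open>r\<close>. If there is none, the contradictory combination of the inequalities has
  multipliers \<open>w\<close> for the load bounds and \<open>s\<close> for the total.
\<close>

lemma separating_weight:
  fixes F :: "nat \<Rightarrow> 'v set"
  assumes V: "finite V" and F: "\<And>j. j \<in> {1..q} \<Longrightarrow> F j \<subseteq> V"
    and not: "\<not> frac_covers F q r b"
  shows "\<exists>(w :: 'v \<Rightarrow> rat) s. (\<forall>v. w v \<ge> 0) \<and> (\<forall>j\<in>{1..q}. s \<le> (\<Sum>v\<in>F j. w v)) \<and>
    (\<Sum>v\<in>V. w v * of_nat (b v)) < s * of_nat r"
proof -
  let ?J = "{1..q}"
  \<comment> \<open>load bounds, the lower bound on the total, and nonnegativity\<close>
  define L where "L = (\<lambda>v. (\<lambda>j. of_bool (v \<in> F j), of_nat (b v)) :: (nat \<Rightarrow> rat) \<times> rat)"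
  define S where "S = ((\<lambda>j. - 1, - of_nat r) :: (nat \<Rightarrow> rat) \<times> rat)"
  define T where "T = (\<lambda>i. (\<lambda>j. - of_bool (j = i), 0) :: (nat \<Rightarrow> rat) \<times> rat)"
  define K where "K = L ` V \<union> {S} \<union> T ` ?J"
  have finK: "finite K" unfolding K_def using V by auto
  have finF: "finite (F j)" if "j \<in> ?J" for j using F[OF that] V finite_subset by blast
  have "\<not> (\<exists>x. \<forall>\<kappa>\<in>K. (\<Sum>j\<in>?J. fst \<kappa> j * x j) \<le> snd \<kappa>)"
  proof
    assume "\<exists>x. \<forall>\<kappa>\<in>K. (\<Sum>j\<in>?J. fst \<kappa> j * x j) \<le> snd \<kappa>"
    then obtain x where x: "\<And>\<kappa>. \<kappa> \<in> K \<Longrightarrow> (\<Sum>j\<in>?J. fst \<kappa> j * x j) \<le> snd \<kappa>" by blast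
    have x0: "x i \<ge> 0" if "i \<in> ?J" for i
    proof -
      have "(\<Sum>j\<in>?J. - of_bool (j = i) * x j) \<le> 0"
        using x[of "T i"] that unfolding K_def T_def by simp
      moreover have "(\<Sum>j\<in>?J. - of_bool (j = i) * x j) = (\<Sum>j\<in>?J. if j = i then - x j else 0)"
        by (intro sum.cong) auto
      ultimately show ?thesis using that by (subst (asm) sum.delta) auto
    qed
    have xL: "(\<Sum>j\<in>{j \<in> ?J. v \<in> F j}. x j) \<le> of_nat (b v)" if "v \<in> V" for v
    proof -
      have "(\<Sum>j\<in>?J. of_bool (v \<in> F j) * x j) \<le> of_nat (b v)"
        using x[of "L v"] that unfolding K_def L_def by simp
      moreover have "(\<Sum>j\<in>?J. of_bool (v \<in> F j) * x j) = (\<Sum>j\<in>{j \<in> ?J. v \<in> F j}. x j)"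
        by (subst sum.inter_filter) (auto simp: of_bool_def if_distrib intro!: sum.cong)
      ultimately show ?thesis by simp
    qed
    have xS: "of_nat r \<le> (\<Sum>j\<in>?J. x j)"
      using x[of S] unfolding K_def S_def by (simp add: sum_negf)
    obtain N a where N: "N \<ge> 1" and a: "\<And>j. j \<in> ?J \<Longrightarrow> of_nat N * x j = of_nat (a j)"
      using common_denominator[of ?J x] x0 by auto
    have "of_nat N * of_nat r \<le> of_nat N * (\<Sum>j\<in>?J. x j)"
      using xS by (intro mult_left_mono) auto
    then have "(of_nat (N * r) :: rat) \<le> of_nat (\<Sum>j\<in>?J. a j)"
      unfolding sum_distrib_left by (simp add: a)
    then have Nr: "N * r \<le> (\<Sum>j\<in>?J. a j)" by (simp only: of_nat_le_iff)
    have La: "load F q a v \<le> N * b v" for v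
    proof (cases "v \<in> V")
      case True
      have "(of_nat (load F q a v) :: rat) = of_nat N * (\<Sum>j\<in>{j \<in> ?J. v \<in> F j}. x j)"
        unfolding load_def sum_distrib_left of_nat_sum by (intro sum.cong) (auto simp: a)
      also have "\<dots> \<le> of_nat (N * b v)" using xL[OF True] N by simp
      finally show ?thesis by (simp only: of_nat_le_iff)
    next
      case False
      then have "{j \<in> ?J. v \<in> F j} = {}" using F by auto
      then show ?thesis unfolding load_def by (simp only: sum.empty)
    qed
    obtain a' where a': "\<And>j. a' j \<le> a j" "(\<Sum>j\<in>?J. a' j) = N * r"
      using bounded_subsum[of ?J "N * r" a] Nr by auto
    have "load F q a' v \<le> N * b v" for v
      using load_mono[of q a' a F v] a'(1) La[of v] le_trans by blast
    then have "covers F q (N * r) (\<lambda>v. N * b v)" using a'(2) by (intro coversI)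
    then show False using not N unfolding frac_covers_def by blast
  qed
  then have "\<not> (\<forall>\<kappa>. \<kappa> \<in> cone K \<longrightarrow> (\<forall>j\<in>?J. fst \<kappa> j = 0) \<longrightarrow> 0 \<le> snd \<kappa>)"
    using farkas[of ?J K, OF finite_atLeastAtMost finK] by fast
  then obtain \<kappa> where \<kappa>: "\<kappa> \<in> cone K" "\<forall>j\<in>?J. fst \<kappa> j = 0" "snd \<kappa> < 0"
    unfolding not_all not_imp not_le by fast
  define cert where "cert \<kappa> w s t \<longleftrightarrow> (\<forall>v. w v \<ge> 0) \<and> (\<forall>i. t i \<ge> 0) \<and>
      (\<forall>j\<in>?J. fst \<kappa> j + s + t j = (\<Sum>v\<in>F j. w v)) \<and>
      snd \<kappa> + s * of_nat r = (\<Sum>v\<in>V. w v * of_nat (b v))"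
    for \<kappa> :: "(nat \<Rightarrow> rat) \<times> rat" and w :: "'v \<Rightarrow> rat" and s and t :: "nat \<Rightarrow> rat"
  have "\<exists>w s t. cert \<kappa> w s t"
    using \<kappa>(1)
  proof induction
    case (gen \<kappa>)
    then consider v where "v \<in> V" "\<kappa> = L v" | "\<kappa> = S" | i where "i \<in> ?J" "\<kappa> = T i"
      unfolding K_def by blast
    then show ?case
    proof cases
      case 1
      have "fst \<kappa> j = (\<Sum>u\<in>F j. if u = v then 1 else 0)" if "j \<in> ?J" for j
        using 1 finF[OF that] unfolding L_def by (simp add: sum.delta)
      moreover have "snd \<kappa> = (\<Sum>u\<in>V. (if u = v then 1 else 0) * of_nat (b u))"
      proof -
        have "(\<Sum>u\<in>V. (if u = v then 1 else 0) * of_nat (b u)) = (\<Sum>u\<in>V. if u = v then (of_nat (b u) :: rat) else 0)"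
          by (intro sum.cong) auto
        then show ?thesis using 1 V unfolding L_def by (simp add: sum.delta)
      qed
      ultimately have "cert \<kappa> (\<lambda>u. if u = v then 1 else 0) 0 (\<lambda>_. 0)"
        unfolding cert_def by simp
      then show ?thesis by blast
    next
      case 2
      then have "cert \<kappa> (\<lambda>_. 0) 1 (\<lambda>_. 0)" unfolding S_def cert_def by simp
      then show ?thesis by blast
    next
      case 3
      then have "cert \<kappa> (\<lambda>_. 0) 0 (\<lambda>j. of_bool (j = i))" unfolding T_def cert_def by simp
      then show ?thesis by blast
    qed
  next
    case (add g h g' h')
    then obtain w s t w' s' t' where c: "cert (g, h) w s t" "cert (g', h') w' s' t'" by blast
    have "g j + g' j + (s + s') + (t j + t' j) = (\<Sum>v\<in>F j. w v + w' v)" if "j \<in> ?J" for j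
    proof -
      have "g j + s + t j = (\<Sum>v\<in>F j. w v)" "g' j + s' + t' j = (\<Sum>v\<in>F j. w' v)"
        using c that unfolding cert_def by auto
      then show ?thesis unfolding sum.distrib by linarith
    qed
    moreover have "h + h' + (s + s') * of_nat r = (\<Sum>v\<in>V. (w v + w' v) * of_nat (b v))"
      using c unfolding cert_def distrib_right sum.distrib by simp
    ultimately have "cert (\<lambda>i. g i + g' i, h + h') (\<lambda>v. w v + w' v) (s + s') (\<lambda>v. t v + t' v)"
      using c unfolding cert_def by auto
    then show ?case by blast
  next
    case (scale g h l)
    then obtain w s t where c: "cert (g, h) w s t" by blast
    have "l * g j + l * s + l * t j = (\<Sum>v\<in>F j. l * w v)" if "j \<in> ?J" for j
    proof -
      have "l * (g j + s + t j) = l * (\<Sum>v\<in>F j. w v)" using c that unfolding cert_def by auto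
      then show ?thesis unfolding sum_distrib_left by (simp only: distrib_left)
    qed
    moreover have "l * h + l * s * of_nat r = (\<Sum>v\<in>V. l * w v * of_nat (b v))"
    proof -
      have "l * (h + s * of_nat r) = l * (\<Sum>v\<in>V. w v * of_nat (b v))" using c unfolding cert_def by auto
      then show ?thesis unfolding sum_distrib_left by (simp only: distrib_left mult.assoc)
    qed
    ultimately have "cert (\<lambda>i. l * g i, l * h) (\<lambda>v. l * w v) (l * s) (\<lambda>v. l * t v)"
      using c scale(2) unfolding cert_def by auto
    then show ?case by blast
  qed
  then obtain w s t where cert: "cert \<kappa> w s t" by blast
  have "s \<le> (\<Sum>v\<in>F j. w v)" if "j \<in> ?J" for j
  proof -
    have "s + t j = (\<Sum>v\<in>F j. w v)" "t j \<ge> 0" using cert \<kappa>(2) that unfolding cert_def by auto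
    then show ?thesis by linarith
  qed
  moreover have "\<And>v. w v \<ge> 0" "(\<Sum>v\<in>V. w v * of_nat (b v)) < s * of_nat r"
    using cert \<kappa>(3) unfolding cert_def by auto
  ultimately show ?thesis by blast
qed

section \<open>The determinant trick\<close>

text \<open>
  Values at \<open>f\<close> of polynomials of degree at most \<open>n\<close> whose coefficient at degree \<open>n - i\<close> lies in \<open>J i\<close>,
  with top coefficient \<open>c\<close>.
\<close>

definition graded_values :: "(nat \<Rightarrow> 'a::comm_ring_1 set) \<Rightarrow> 'a \<Rightarrow> nat \<Rightarrow> 'a \<Rightarrow> 'a set" where
  "graded_values J f n c =
    {x. \<exists>a. a 0 = c \<and> (\<forall>i\<le>n. a i \<in> J i) \<and> x = (\<Sum>i\<le>n. a i * f ^ (n - i))}"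

text \<open>
  The closure properties of the powers of an ideal that the determinant expansion uses.
\<close>

locale ideal_filtration =
  fixes J :: "nat \<Rightarrow> 'a::comm_ring_1 set"
  assumes zero: "0 \<in> J i" and one: "1 \<in> J 0"
    and add: "x \<in> J i \<Longrightarrow> y \<in> J i \<Longrightarrow> x + y \<in> J i"
    and uminus: "x \<in> J i \<Longrightarrow> - x \<in> J i"
    and mult: "x \<in> J i \<Longrightarrow> y \<in> J k \<Longrightarrow> x * y \<in> J (i + k)"

begin

lemma graded_values_add:
  assumes "x \<in> graded_values J f n c" "y \<in> graded_values J f n c'"
  shows "x + y \<in> graded_values J f n (c + c')"
proof -
  obtain a b where "a 0 = c" "\<forall>i\<le>n. a i \<in> J i" "x = (\<Sum>i\<le>n. a i * f ^ (n - i))"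
    "b 0 = c'" "\<forall>i\<le>n. b i \<in> J i" "y = (\<Sum>i\<le>n. b i * f ^ (n - i))"
    using assms unfolding graded_values_def by blast
  then show ?thesis
    unfolding graded_values_def
    by (intro CollectI exI[of _ "\<lambda>i. a i + b i"]) (auto simp: add sum.distrib distrib_right)
qed

lemma graded_values_0: "0 \<in> graded_values J f n 0"
  unfolding graded_values_def by (intro CollectI exI[of _ "\<lambda>_. 0"]) (auto simp: zero)

lemma graded_values_uminus:
  assumes "x \<in> graded_values J f n c"
  shows "- x \<in> graded_values J f n (- c)"
proof -
  obtain a where "a 0 = c" "\<forall>i\<le>n. a i \<in> J i" "x = (\<Sum>i\<le>n. a i * f ^ (n - i))"
    using assms unfolding graded_values_def by blast
  then show ?thesis
    unfolding graded_values_def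
    by (intro CollectI exI[of _ "\<lambda>i. - a i"]) (auto simp: uminus sum_negf)
qed

lemma graded_values_sum:
  assumes "\<And>s. s \<in> X \<Longrightarrow> x s \<in> graded_values J f n (c s)"
  shows "(\<Sum>s\<in>X. x s) \<in> graded_values J f n (\<Sum>s\<in>X. c s)"
  using assms
  by (induction X rule: infinite_finite_induct) (auto simp: graded_values_0 intro: graded_values_add)

lemma graded_values_linear_factor:
  assumes x: "x \<in> graded_values J f n c" and m: "m \<in> J 1" and \<delta>: "\<delta> = 0 \<or> \<delta> = 1"
  shows "x * (\<delta> * f - m) \<in> graded_values J f (Suc n) (c * \<delta>)"
proof -
  obtain a where a: "a 0 = c" "\<And>i. i \<le> n \<Longrightarrow> a i \<in> J i" "x = (\<Sum>i\<le>n. a i * f ^ (n - i))"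
    using x unfolding graded_values_def by blast
  define b1 where "b1 i = (if i \<le> n then a i * \<delta> else 0)" for i
  define b2 where "b2 i = (case i of 0 \<Rightarrow> 0 | Suc i' \<Rightarrow> - (a i' * m))" for i
  have "x * (\<delta> * f) = (\<Sum>i\<le>Suc n. b1 i * f ^ (Suc n - i))"
    unfolding a(3) b1_def sum_distrib_right by (auto simp: Suc_diff_le algebra_simps intro!: sum.cong)
  moreover have "- (x * m) = (\<Sum>i\<le>Suc n. b2 i * f ^ (Suc n - i))"
    unfolding a(3) b2_def
    by (subst sum.atMost_Suc_shift) (simp add: sum_distrib_right sum_negf mult.assoc mult.commute[of m])
  moreover have "b1 i \<in> J i" if "i \<le> Suc n" for i
    using a(2) \<delta> zero unfolding b1_def by auto
  moreover have "b2 i \<in> J i" if "i \<le> Suc n" for i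
    using that zero mult[OF a(2) m] uminus unfolding b2_def by (cases i) auto
  ultimately show ?thesis
    unfolding graded_values_def
    by (intro CollectI exI[of _ "\<lambda>i. b1 i + b2 i"])
      (auto simp: add distrib_right sum.distrib right_diff_distrib a(1) b1_def[of 0] b2_def[of 0])
qed

lemma graded_values_prod_linear:
  assumes "\<And>i. i < n \<Longrightarrow> m i \<in> J 1" "\<And>i. i < n \<Longrightarrow> \<delta> i = 0 \<or> \<delta> i = 1"
  shows "(\<Prod>i=0..<n. \<delta> i * f - m i) \<in> graded_values J f n (\<Prod>i=0..<n. \<delta> i)"
  using assms
proof (induction n)
  case 0
  then show ?case unfolding graded_values_def using one by (auto intro!: exI[of _ "\<lambda>_. 1"])
next
  case (Suc n)
  then show ?case by (simp add: graded_values_linear_factor)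
qed

text \<open>
  In the Leibniz expansion of \<open>f 1 - m\<close> only the identity permutation contributes the power \<open>f ^ n\<close>,
  and every entry taken from \<open>m\<close> replaces a factor \<open>f\<close> by an element of \<open>J 1\<close>.
\<close>

lemma det_in_graded_values:
  assumes m: "\<And>i j. i < n \<Longrightarrow> j < n \<Longrightarrow> m i j \<in> J 1"
  shows "det (mat n n (\<lambda>(i, j). of_bool (i = j) * f - m i j)) \<in> graded_values J f n 1"
proof -
  let ?A = "mat n n (\<lambda>(i, j). of_bool (i = j) * f - m i j)"
  let ?P = "{p. p permutes {0..<n}}"
  let ?c = "\<lambda>p. \<Prod>i=0..<n. (of_bool (i = p i) :: 'a)"
  have "signof p * (\<Prod>i=0..<n. ?A $$ (i, p i)) \<in> graded_values J f n (signof p * ?c p)"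
    if p: "p \<in> ?P" for p
  proof -
    have pi: "p i < n" if "i < n" for i using permutes_in_image[of p "{0..<n}" i] p that by simp
    have "(\<Prod>i=0..<n. of_bool (i = p i) * f - m i (p i)) \<in> graded_values J f n (?c p)"
      using pi m by (intro graded_values_prod_linear) auto
    moreover have "(\<Prod>i=0..<n. ?A $$ (i, p i)) = (\<Prod>i=0..<n. of_bool (i = p i) * f - m i (p i))"
      using pi by (intro prod.cong) auto
    ultimately have *: "(\<Prod>i=0..<n. ?A $$ (i, p i)) \<in> graded_values J f n (?c p)" by simp
    show ?thesis
      by (cases "evenperm p") (use * graded_values_uminus[OF *] in \<open>auto simp: sign_def\<close>)
  qed
  then have "det ?A \<in> graded_values J f n (\<Sum>p\<in>?P. signof p * ?c p)"
    unfolding det_def'[OF mat_carrier] by (rule graded_values_sum)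
  moreover have "(\<Sum>p\<in>?P. signof p * ?c p) = (\<Sum>p\<in>?P. if p = id then 1 else 0)"
  proof (rule sum.cong[OF refl])
    fix p assume p: "p \<in> ?P"
    show "signof p * ?c p = (if p = id then 1 else 0)"
    proof (cases "p = id")
      case False
      then obtain i where "p i \<noteq> i" by fastforce
      then have "i \<in> {0..<n}" using p permutes_not_in[of p "{0..<n}" i] by (metis mem_Collect_eq)
      moreover from this have "?c p = 0"
        using \<open>p i \<noteq> i\<close> by (intro prod_zero) (auto intro!: bexI[of _ i])
      ultimately show ?thesis using False by simp
    qed (simp add: sign_id)
  qed
  moreover have "\<dots> = 1" by (subst sum.delta) (auto simp: finite_permutations permutes_id)
  ultimately show ?thesis by simp
qed

end

text \<open>
  The vector of the elements of \<open>G\<close> is a nonzero kernel vector of \<open>f 1 - M\<close>, so the determinant of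
  this matrix vanishes over a domain; its expansion is the integral equation.
\<close>

theorem integral_equation_if_stable_module:
  fixes J :: "nat \<Rightarrow> 'a::idom set"
  assumes J: "ideal_filtration J"
    and G: "finite G" "g \<in> G" "g \<noteq> 0"
    and M: "\<And>x y. x \<in> G \<Longrightarrow> y \<in> G \<Longrightarrow> M x y \<in> J 1"
    and f: "\<And>x. x \<in> G \<Longrightarrow> f * x = (\<Sum>y\<in>G. M x y * y)"
  shows "\<exists>d\<ge>1. \<exists>a. (\<forall>i\<in>{1..d}. a i \<in> J i) \<and> f ^ d + (\<Sum>i\<in>{1..d}. a i * f ^ (d - i)) = 0"
proof -
  interpret ideal_filtration J by (rule J)
  define n where "n = card G"
  obtain h where h: "bij_betw h {0..<n} G"
    using G(1) ex_bij_betw_nat_finite unfolding n_def by blast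
  have hG: "h i \<in> G" if "i < n" for i using h that unfolding bij_betw_def by auto
  have n: "n \<ge> 1" using G unfolding n_def by (simp add: Suc_le_eq card_gt_0_iff) blast
  define A where "A = mat n n (\<lambda>(i, j). of_bool (i = j) * f - M (h i) (h j))"
  define v where "v = vec n h"
  have "A *\<^sub>v v = 0\<^sub>v n"
  proof (rule eq_vecI)
    fix i assume "i < dim_vec (0\<^sub>v n)"
    then have i: "i < n" by simp
    have "(A *\<^sub>v v) $ i = (\<Sum>j=0..<n. (of_bool (i = j) * f - M (h i) (h j)) * h j)"
      using i unfolding A_def v_def by (simp add: scalar_prod_def)
    also have "\<dots> = (\<Sum>j=0..<n. (if i = j then f * h i else 0)) - (\<Sum>j=0..<n. M (h i) (h j) * h j)"
      unfolding sum_subtractf[symmetric] by (intro sum.cong) (auto simp: algebra_simps)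
    also have "(\<Sum>j=0..<n. (if i = j then f * h i else 0)) = f * h i"
      using i by (subst sum.delta') auto
    also have "(\<Sum>j=0..<n. M (h i) (h j) * h j) = (\<Sum>y\<in>G. M (h i) y * y)"
      using sum.reindex_bij_betw[OF h, of "\<lambda>y. M (h i) y * y"] .
    finally show "(A *\<^sub>v v) $ i = 0\<^sub>v n $ i" using f[OF hG[OF i]] i by simp
  qed (simp add: A_def)
  moreover have "v \<noteq> 0\<^sub>v n"
  proof
    assume v0: "v = 0\<^sub>v n"
    obtain i where "i < n" "h i = g" using h G(2) unfolding bij_betw_def by auto
    then have "v $ i = g" unfolding v_def by simp
    moreover have "v $ i = 0" using v0 \<open>i < n\<close> by simp
    ultimately show False using G(3) by simp
  qed
  moreover have "v \<in> carrier_vec n" "A \<in> carrier_mat n n" unfolding v_def A_def by auto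
  ultimately have "det A = 0" using det_0_iff_vec_prod_zero[of A n] by blast
  moreover have "det A \<in> graded_values J f n 1"
    unfolding A_def using M hG by (intro det_in_graded_values) auto
  ultimately obtain a where a: "a 0 = 1" "\<forall>i\<le>n. a i \<in> J i" "0 = (\<Sum>i\<le>n. a i * f ^ (n - i))"
    unfolding graded_values_def by auto
  have "(\<Sum>i\<le>n. a i * f ^ (n - i)) = f ^ n + (\<Sum>i\<in>{1..n}. a i * f ^ (n - i))"
  proof -
    have "{..n} = insert 0 {1..n}" by auto
    then show ?thesis using a(1) by simp
  qed
  then have "f ^ n + (\<Sum>i\<in>{1..n}. a i * f ^ (n - i)) = 0" using a(3) by simp
  moreover have "\<forall>i\<in>{1..n}. a i \<in> J i" using a(2) by simp
  ultimately show ?thesis using n by blast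
qed

section \<open>Monomials and monomial ideals\<close>

abbreviation lookup where "lookup \<equiv> Poly_Mapping.lookup"

abbreviation keys where "keys \<equiv> Poly_Mapping.keys"

abbreviation xpow :: "('v \<Rightarrow>\<^sub>0 nat) \<Rightarrow> ('v, 'k::comm_ring_1) mpoly" where
  "xpow e \<equiv> Poly_Mapping.single e 1"

text \<open>
  The exponent vector with entries \<open>b v\<close> at \<open>v \<in> V\<close>; it is the constant function \<open>1\<close> on the
  support that gives a squarefree monomial.
\<close>

definition exponent_of :: "'v set \<Rightarrow> ('v \<Rightarrow> nat) \<Rightarrow> 'v \<Rightarrow>\<^sub>0 nat" where
  "exponent_of V b = (\<Sum>v\<in>V. Poly_Mapping.single v (b v))"

abbreviation sqf :: "'v set \<Rightarrow> ('v, 'k::comm_ring_1) mpoly" where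
  "sqf A \<equiv> xpow (exponent_of A (\<lambda>_. 1))"

lemma lookup_exponent_of:
  assumes "finite V"
  shows "lookup (exponent_of V b) v = (if v \<in> V then b v else 0)"
proof -
  have "lookup (exponent_of V b) v = (\<Sum>u\<in>V. if u = v then b u else 0)"
    unfolding exponent_of_def by (simp add: lookup_sum lookup_single when_def)
  then show ?thesis using assms by (simp add: sum.delta)
qed

lemma keys_exponent_of: "finite V \<Longrightarrow> keys (exponent_of V b) \<subseteq> V"
  by (auto simp: in_keys_iff lookup_exponent_of split: if_splits)

lemma exponent_minus_add:
  fixes d e :: "'v \<Rightarrow>\<^sub>0 nat"
  assumes "\<And>v. lookup d v \<le> lookup e v"
  shows "e = d + (e - d)"
  using assms by (intro poly_mapping_eqI) (simp add: lookup_add lookup_minus)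

lemma xpow_add: "xpow (d + e) = xpow d * xpow e"
  by (simp add: mult_single)

lemma xpow_power: "xpow d ^ n = xpow (\<Sum>i<n. d)"
  by (induction n) (simp_all add: mult_single add.commute)

lemma xpow_prod: "(\<Prod>x\<in>X. xpow (d x)) = xpow (\<Sum>x\<in>X. d x)"
  by (induction X rule: infinite_finite_induct) (simp_all add: mult_single)

lemma single_eq_const_mult: "Poly_Mapping.single e c = mp_const c * xpow e"
  by (simp add: mp_const_def mult_single)

lemma prod_mp_var: "(\<Prod>v\<in>V. mp_var v) = xpow (exponent_of V (\<lambda>_. 1))"
  unfolding exponent_of_def
  by (induction V rule: infinite_finite_induct) (simp_all add: mp_var_def mult_single)

lemma sum_of_monomials: "p = (\<Sum>e\<in>keys p. Poly_Mapping.single e (lookup p e))"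
  by (rule poly_mapping_eqI)
    (auto simp: lookup_sum lookup_single when_def in_keys_iff sum.delta)

lemma xpow_closed: "keys e \<subseteq> V \<Longrightarrow> xpow e \<in> carrier (mpoly_ring V)"
  by (simp add: mpoly_ring_carrier)

lemma mpoly_ring_pow: "p [^]\<^bsub>mpoly_ring V\<^esub> (n::nat) = p ^ n"
  by (induction n) (simp_all add: mult.commute)

lemma mpoly_ring_power_closed:
  "p \<in> carrier (mpoly_ring V) \<Longrightarrow> p ^ n \<in> carrier (mpoly_ring V)"
  by (induction n) (simp_all add: mpoly_ring_closed)

lemma mpoly_ring_sum_closed:
  "(\<And>x. x \<in> X \<Longrightarrow> p x \<in> carrier (mpoly_ring V)) \<Longrightarrow> (\<Sum>x\<in>X. p x) \<in> carrier (mpoly_ring V)"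
  by (induction X rule: infinite_finite_induct) (simp_all add: mpoly_ring_closed)

lemma mpoly_ring_finsum:
  fixes p :: "'i \<Rightarrow> ('v, 'k::comm_ring_1) mpoly"
  assumes "finite X" "\<And>x. x \<in> X \<Longrightarrow> p x \<in> carrier (mpoly_ring V)"
  shows "(\<Oplus>\<^bsub>mpoly_ring V\<^esub>x\<in>X. p x) = (\<Sum>x\<in>X. p x)"
proof -
  interpret cring "mpoly_ring V :: ('v, 'k) mpoly ring" by (rule cring_mpoly_ring)
  show ?thesis using assms
    by (induction X rule: finite_induct) (simp_all add: finsum_insert Pi_def)
qed

lemma ideal_sum_closed:
  assumes "ideal K (mpoly_ring V)" "\<And>x. x \<in> X \<Longrightarrow> p x \<in> K"
  shows "(\<Sum>x\<in>X. p x) \<in> K"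
proof -
  interpret ideal K "mpoly_ring V" by (rule assms(1))
  have "0 \<in> K" "x \<in> K \<Longrightarrow> y \<in> K \<Longrightarrow> x + y \<in> K" for x y
    using additive_subgroup.zero_closed[OF is_additive_subgroup]
      additive_subgroup.a_closed[OF is_additive_subgroup, of x y] by simp_all
  then show ?thesis using assms(2)
    by (induction X rule: infinite_finite_induct) auto
qed

lemma ideal_mult_closed:
  assumes "ideal K (mpoly_ring V)" "x \<in> carrier (mpoly_ring V)" "p \<in> K"
  shows "x * p \<in> K"
  using ideal.I_l_closed[OF assms(1,3,2)] by simp

lemma in_ideal_if_monomials:
  assumes K: "ideal K (mpoly_ring V)" and p: "\<And>e. e \<in> keys p \<Longrightarrow> xpow e \<in> K"
  shows "p \<in> K"
proof -
  have "mp_const (lookup p e) * xpow e \<in> K" if "e \<in> keys p" for e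
    by (rule ideal_mult_closed[OF K mpoly_ring_closed(3) p[OF that]])
  then have "(\<Sum>e\<in>keys p. Poly_Mapping.single e (lookup p e)) \<in> K"
    by (intro ideal_sum_closed[OF K]) (simp add: single_eq_const_mult[symmetric])
  then show ?thesis using sum_of_monomials[of p] by simp
qed

text \<open>
  The condition \<open>\<Phi>\<close> is on functions, so that conditions such as \<open>covers F q r\<close> can be used directly.
\<close>

definition monomial_set :: "'v set \<Rightarrow> (('v \<Rightarrow> nat) \<Rightarrow> bool) \<Rightarrow> ('v, 'k::comm_ring_1) mpoly set" where
  "monomial_set V \<Phi> = {p \<in> carrier (mpoly_ring V). \<forall>e\<in>keys p. \<Phi> (lookup e)}"

lemma ideal_monomial_set:
  fixes V :: "'v set"
  assumes \<Phi>: "\<And>b b'. \<Phi> b \<Longrightarrow> (\<And>v. b v \<le> b' v) \<Longrightarrow> \<Phi> b'"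
  shows "ideal (monomial_set V \<Phi>) (mpoly_ring V :: ('v, 'k::comm_ring_1) mpoly ring)"
proof -
  let ?R = "mpoly_ring V :: ('v, 'k) mpoly ring"
  interpret cring ?R by (rule cring_mpoly_ring)
  have mult: "x * p \<in> monomial_set V \<Phi>"
    if "p \<in> monomial_set V \<Phi>" "x \<in> carrier ?R" for x p :: "('v, 'k) mpoly"
  proof -
    have "\<Phi> (lookup e)" if e: "e \<in> keys (x * p)" for e
    proof -
      obtain d c where "e = d + c" "c \<in> keys p" using keys_mult[of x p] e by blast
      then show ?thesis
        using \<Phi>[of "lookup c" "lookup e"] \<open>p \<in> _\<close> unfolding monomial_set_def by (auto simp: lookup_add)
    qed
    then show ?thesis using that unfolding monomial_set_def by (auto simp: mpoly_ring_closed)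
  qed
  show ?thesis
  proof (rule idealI)
    show "ring ?R" by (rule ring_axioms)
    show "subgroup (monomial_set V \<Phi>) (add_monoid ?R)"
    proof (rule add.subgroupI)
      show "monomial_set V \<Phi> \<subseteq> carrier ?R" unfolding monomial_set_def by blast
      have "0 \<in> monomial_set V \<Phi>" unfolding monomial_set_def by (simp add: mpoly_ring_closed)
      then show "monomial_set V \<Phi> \<noteq> {}" by blast
    next
      fix p :: "('v, 'k) mpoly" assume p: "p \<in> monomial_set V \<Phi>"
      then have pc: "p \<in> carrier ?R" unfolding monomial_set_def by blast
      have "\<ominus>\<^bsub>?R\<^esub> p = - p"
        using r_neg[OF pc] mpoly_ring_closed(7)[OF pc] by (metis add_eq_0_iff mpoly_ring_simps(3,4))
      then show "\<ominus>\<^bsub>?R\<^esub> p \<in> monomial_set V \<Phi>"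
        using p mpoly_ring_closed(7)[OF pc] unfolding monomial_set_def by simp
    next
      fix p p' :: "('v, 'k) mpoly" assume "p \<in> monomial_set V \<Phi>" "p' \<in> monomial_set V \<Phi>"
      then show "p \<oplus>\<^bsub>?R\<^esub> p' \<in> monomial_set V \<Phi>"
        using Poly_Mapping.keys_add[of p p'] unfolding monomial_set_def
        by (auto simp: mpoly_ring_closed)
    qed
  qed (use mult in \<open>simp_all add: mult.commute\<close>)
qed

lemma ideal_monomial_covers:
  "ideal (monomial_set V (covers F q r)) (mpoly_ring V :: ('v, 'k::comm_ring_1) mpoly ring)"
  by (rule ideal_monomial_set) (rule covers_mono)

lemma ideal_monomial_frac_covers:
  "ideal (monomial_set V (frac_covers F q r)) (mpoly_ring V :: ('v, 'k::comm_ring_1) mpoly ring)"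
  by (rule ideal_monomial_set) (rule frac_covers_mono)

section \<open>Powers of ideals generated by squarefree monomials\<close>

text \<open>
  Both the given ideal and the extremal ideal are instances. The ring and the ideal are
  parameters with defining equations, which lets the instances keep their own names for them.
\<close>

locale squarefree_generators =
  fixes V :: "'v set" and F :: "nat \<Rightarrow> 'v set" and q :: nat
    and R :: "('v, 'k::comm_ring_1) mpoly ring" and I :: "('v, 'k) mpoly set"
  assumes finite_V: "finite V" and F_sub: "\<And>j. j \<in> {1..q} \<Longrightarrow> F j \<subseteq> V"
    and R: "R = mpoly_ring V"
    and I: "I = Idl\<^bsub>R\<^esub> ((\<lambda>j. \<Prod>v\<in>F j. mp_var v) ` {1..q})"

begin

sublocale R: cring R unfolding R by (rule cring_mpoly_ring)

sublocale ideals: Group.comm_monoid "ideals_set R" by (rule R.ideals_set_is_comm_monoid)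

lemma finite_F: "j \<in> {1..q} \<Longrightarrow> finite (F j)"
  using F_sub finite_V finite_subset by blast

lemma gen_closed: "j \<in> {1..q} \<Longrightarrow> sqf (F j) \<in> carrier R"
  unfolding R using F_sub keys_exponent_of[OF finite_F] by (blast intro: xpow_closed)

lemma gens_closed: "(\<lambda>j. \<Prod>v\<in>F j. mp_var v) ` {1..q} \<subseteq> carrier R"
  unfolding prod_mp_var using gen_closed by blast

lemma ideal_I: "ideal I R"
  unfolding I by (rule R.genideal_ideal[OF gens_closed])

lemma gen_in_I: "j \<in> {1..q} \<Longrightarrow> sqf (F j) \<in> I"
  using R.genideal_self[OF gens_closed] unfolding I prod_mp_var by blast

lemma I_eq_covers: "I = monomial_set V (covers F q 1)"
proof
  have "sqf (F j) \<in> (monomial_set V (covers F q 1) :: ('v, 'k) mpoly set)" if j: "j \<in> {1..q}" for j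
    using gen_closed[OF j] j unfolding monomial_set_def R covers_1_iff
    by (auto simp: lookup_exponent_of finite_F)
  then show "I \<subseteq> monomial_set V (covers F q 1)"
    unfolding I prod_mp_var
    by (intro R.genideal_minimal) (auto simp: R intro: ideal_monomial_covers)
next
  show "monomial_set V (covers F q 1) \<subseteq> I"
  proof
    fix p :: "('v, 'k) mpoly" assume p: "p \<in> monomial_set V (covers F q 1)"
    show "p \<in> I"
    proof (rule in_ideal_if_monomials)
      show "ideal I (mpoly_ring V)" using ideal_I unfolding R .
      fix e assume e: "e \<in> keys p"
      then obtain j where j: "j \<in> {1..q}" "\<And>v. v \<in> F j \<Longrightarrow> 1 \<le> lookup e v"
        using p unfolding monomial_set_def covers_1_iff by blast
      let ?g = "exponent_of (F j) (\<lambda>_. 1)"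
      have eq: "e = ?g + (e - ?g)"
        using j(2) by (intro exponent_minus_add) (simp add: lookup_exponent_of finite_F[OF j(1)])
      have "keys (e - ?g) \<subseteq> keys e" by (auto simp: in_keys_iff lookup_minus)
      then have "keys (e - ?g) \<subseteq> V" using e p unfolding monomial_set_def mpoly_ring_carrier by blast
      then have "xpow (e - ?g) * xpow ?g \<in> I"
        using ideal_I gen_in_I[OF j(1)] unfolding R by (intro ideal_mult_closed xpow_closed)
      then show "xpow e \<in> I" by (subst eq) (simp add: xpow_add mult.commute)
    qed
  qed
qed

text \<open>
  A cover of level \<open>r + 1\<close> uses some generator, and removing one copy of it leaves a cover of level
  \<open>r\<close>; so each monomial of the right-hand side is a product from \<open>I\<^sup>r\<close> and \<open>I\<close>.
\<close>

lemma I_power_eq_covers: "I [^]\<^bsub>ideals_set R\<^esub> r = monomial_set V (covers F q r)"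
proof (induction r)
  case 0
  have "monomial_set V (covers F q 0) = carrier R"
    unfolding monomial_set_def R by (auto intro!: coversI[where a = "\<lambda>_. 0"] simp: load_def)
  then show ?case by (simp add: ideals_set_def)
next
  case (Suc r)
  have "I [^]\<^bsub>ideals_set R\<^esub> Suc r = ideal_prod R (monomial_set V (covers F q r)) I"
    using Suc by (simp add: ideals_set_def)
  also have "\<dots> = monomial_set V (covers F q (Suc r))"
  proof
    show "ideal_prod R (monomial_set V (covers F q r)) I \<subseteq> monomial_set V (covers F q (Suc r))"
    proof
      fix x assume "x \<in> ideal_prod R (monomial_set V (covers F q r)) I"
      then show "x \<in> monomial_set V (covers F q (Suc r))"
      proof induction
        case (prod x y)
        have "covers F q (Suc r) (lookup e)" if "e \<in> keys (x * y)" for e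
        proof -
          obtain c d where e: "e = c + d" "c \<in> keys x" "d \<in> keys y" using keys_mult[of x y] \<open>e \<in> _\<close> by blast
          then have "covers F q (r + 1) (\<lambda>v. lookup c v + lookup d v)"
            using prod unfolding I_eq_covers monomial_set_def by (intro covers_add) blast+
          then show ?thesis by (simp add: e(1) lookup_add[abs_def])
        qed
        then show ?case
          using prod unfolding I_eq_covers monomial_set_def R by (auto simp: mpoly_ring_closed)
      next
        case (sum x y)
        have "ideal (monomial_set V (covers F q (Suc r))) R"
          unfolding R by (rule ideal_monomial_covers)
        from additive_subgroup.a_closed[OF ideal.axioms(1)[OF this] sum.IH] show ?case .
      qed
    qed
  next
    have ideal: "ideal (ideal_prod R (monomial_set V (covers F q r)) I) R"
      using ideal_I unfolding R by (intro cring_mpoly_ring[THEN cring.axioms(1), THEN ring.ideal_prod_is_ideal] ideal_monomial_covers)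
    show "monomial_set V (covers F q (Suc r)) \<subseteq> ideal_prod R (monomial_set V (covers F q r)) I"
    proof
      fix p :: "('v, 'k) mpoly" assume p: "p \<in> monomial_set V (covers F q (Suc r))"
      show "p \<in> ideal_prod R (monomial_set V (covers F q r)) I"
      proof (rule in_ideal_if_monomials)
        show "ideal (ideal_prod R (monomial_set V (covers F q r)) I) (mpoly_ring V)"
          using ideal unfolding R .
        fix e assume e: "e \<in> keys p"
        then have "covers F q (Suc r) (lookup e)" using p unfolding monomial_set_def by blast
        then obtain j where j: "j \<in> {1..q}" "\<And>v. v \<in> F j \<Longrightarrow> 1 \<le> lookup e v"
          "covers F q r (\<lambda>v. lookup e v - of_bool (v \<in> F j))"
          by (rule covers_Suc_split) blast
        define g where "g = exponent_of (F j) (\<lambda>_. 1 :: nat)"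
        have g: "lookup g v = of_bool (v \<in> F j)" for v
          unfolding g_def by (simp add: lookup_exponent_of finite_F[OF j(1)])
        have eq: "e = g + (e - g)"
          using j(2) by (intro exponent_minus_add) (simp add: g)
        have "keys (e - g) \<subseteq> keys e" by (auto simp: in_keys_iff lookup_minus)
        then have "keys (e - g) \<subseteq> V" using e p unfolding monomial_set_def mpoly_ring_carrier by blast
        then have "xpow (e - g) \<in> monomial_set V (covers F q r)"
          using j(3) unfolding monomial_set_def by (simp add: xpow_closed lookup_minus[abs_def] g)
        moreover have "xpow g \<in> I" unfolding g_def by (rule gen_in_I[OF j(1)])
        ultimately have "xpow (e - g) \<otimes>\<^bsub>R\<^esub> xpow g \<in> ideal_prod R (monomial_set V (covers F q r)) I"
          by (rule ideal_prod.prod)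
        then show "xpow e \<in> ideal_prod R (monomial_set V (covers F q r)) I"
          by (subst eq) (simp add: xpow_add mult.commute R)
      qed
    qed
  qed
  finally show ?case .
qed

lemma xpow_in_power_iff:
  "keys e \<subseteq> V \<Longrightarrow> xpow e \<in> I [^]\<^bsub>ideals_set R\<^esub> r \<longleftrightarrow> covers F q r (lookup e)"
  unfolding I_power_eq_covers monomial_set_def by (simp add: xpow_closed)

lemma ideal_power: "ideal (I [^]\<^bsub>ideals_set R\<^esub> (r::nat)) R"
  unfolding I_power_eq_covers by (subst R) (rule ideal_monomial_covers)

lemma power_power: "(I [^]\<^bsub>ideals_set R\<^esub> r) [^]\<^bsub>ideals_set R\<^esub> i = I [^]\<^bsub>ideals_set R\<^esub> (r * i :: nat)"
  using ideal_I by (intro ideals.nat_pow_pow) (simp add: ideals_set_def)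

lemma integral_closure_power_iff:
  "z \<in> integral_closure R (I [^]\<^bsub>ideals_set R\<^esub> r) \<longleftrightarrow> z \<in> carrier R \<and>
    (\<exists>d\<ge>1. \<exists>a. (\<forall>i\<in>{1..d}. a i \<in> I [^]\<^bsub>ideals_set R\<^esub> (r * i)) \<and>
      z ^ d + (\<Sum>i\<in>{1..d}. a i * z ^ (d - i)) = 0)"
proof -
  have *: "(\<Oplus>\<^bsub>R\<^esub>i\<in>{1..d}. a i \<otimes>\<^bsub>R\<^esub> z [^]\<^bsub>R\<^esub> (d - i)) = (\<Sum>i\<in>{1..d}. a i * z ^ (d - i))"
    if z: "z \<in> carrier R" and a: "\<forall>i\<in>{1..d}. a i \<in> I [^]\<^bsub>ideals_set R\<^esub> (r * i)" for d a
  proof -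
    have "a i * z ^ (d - i) \<in> carrier (mpoly_ring V)" if i: "i \<in> {1..d}" for i
      using z ideal.Icarr[OF ideal_power a[rule_format, OF i]] unfolding R
      by (intro mpoly_ring_closed(6) mpoly_ring_power_closed)
    then show ?thesis unfolding R mpoly_ring_pow by (subst mpoly_ring_finsum) auto
  qed
  have **: "z [^]\<^bsub>R\<^esub> d \<oplus>\<^bsub>R\<^esub> x = \<zero>\<^bsub>R\<^esub> \<longleftrightarrow> z ^ d + x = 0" for d :: nat and x
    by (simp add: R mpoly_ring_pow)
  show ?thesis
    unfolding integral_closure_def power_power mem_Collect_eq **
    by (intro conj_cong ex_cong1 refl) (simp only: *)
qed

text \<open>
  For a monomial the binomial equation \<open>z ^ N - u = 0\<close> with \<open>u = z ^ N \<in> I\<^sup>r\<^sup>N\<close> suffices.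
  It needs no determinant over a domain, so the argument also serves the extremal ring, whose
  variables are sets and carry no linear order.
\<close>

lemma xpow_integral:
  assumes e: "keys e \<subseteq> V" and frac: "frac_covers F q r (lookup e)"
  shows "xpow e \<in> integral_closure R (I [^]\<^bsub>ideals_set R\<^esub> r)"
proof -
  obtain N where N: "N \<ge> 1" and cov: "covers F q (N * r) (\<lambda>v. N * lookup e v)"
    using frac unfolding frac_covers_def by blast
  define z :: "('v, 'k) mpoly" where "z = xpow e"
  have z: "z \<in> carrier R" unfolding z_def R by (rule xpow_closed[OF e])
  have "lookup (\<Sum>i<N. e) = (\<lambda>v. N * lookup e v)"
    by (rule ext) (simp add: lookup_sum)
  then have "covers F q (r * N) (lookup (\<Sum>i<N. e))" using cov by (simp only: mult.commute[of r])
  moreover have "keys (\<Sum>i<N. e) \<subseteq> V" using e by (auto simp: in_keys_iff lookup_sum)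
  ultimately have zN: "z ^ N \<in> I [^]\<^bsub>ideals_set R\<^esub> (r * N)"
    unfolding z_def xpow_power by (simp only: xpow_in_power_iff)
  define a where "a i = (if i = N then - (z ^ N) else 0)" for i
  have "a i \<in> I [^]\<^bsub>ideals_set R\<^esub> (r * i)" for i
  proof (cases "i = N")
    case True
    then show ?thesis using zN unfolding a_def I_power_eq_covers monomial_set_def
      by (simp add: R mpoly_ring_closed)
  next
    case False
    then show ?thesis
      unfolding a_def I_power_eq_covers monomial_set_def by (simp add: R mpoly_ring_closed)
  qed
  moreover have "z ^ N + (\<Sum>i\<in>{1..N}. a i * z ^ (N - i)) = 0"
  proof -
    have "(\<Sum>i\<in>{1..N}. a i * z ^ (N - i)) = (\<Sum>i\<in>{1..N}. if i = N then - (z ^ N) else 0)"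
      unfolding a_def by (intro sum.cong) auto
    also have "\<dots> = - (z ^ N)" using N by (subst sum.delta) auto
    finally show ?thesis by simp
  qed
  ultimately show ?thesis
    unfolding integral_closure_power_iff z_def[symmetric] using z N by blast
qed

end

section \<open>Integral closures of powers of squarefree monomial ideals\<close>

lemma weight_ge_of_power:
  fixes wt :: "('v \<Rightarrow>\<^sub>0 nat) \<Rightarrow> rat" and z :: "('v, 'k::comm_ring_1) mpoly"
  assumes add: "\<And>d e. wt (d + e) = wt d + wt e"
    and z: "\<And>e. e \<in> keys z \<Longrightarrow> \<mu> \<le> wt e" and e: "e \<in> keys (z ^ n)"
  shows "of_nat n * \<mu> \<le> wt e"
  using e
proof (induction n arbitrary: e)
  case 0
  have "wt 0 = 0" using add[of 0 0] by simp
  then show ?case using 0 by simp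
next
  case (Suc n)
  then obtain c d where cd: "e = c + d" "c \<in> keys z" "d \<in> keys (z ^ n)"
    using keys_mult[of z "z ^ n"] by auto
  then show ?case using z[OF cd(2)] Suc.IH[OF cd(3)] by (simp add: add algebra_simps)
qed

text \<open>
  The part \<open>y\<close> of least weight of \<open>z\<close> is a nonzero element of a domain, so \<open>y ^ n \<noteq> 0\<close>, and
  \<open>z ^ n - y ^ n\<close> has only larger weights.
\<close>

lemma weight_of_power_attained:
  fixes wt :: "('v::linorder \<Rightarrow>\<^sub>0 nat) \<Rightarrow> rat" and z :: "('v, 'k::field) mpoly"
  assumes add: "\<And>d e. wt (d + e) = wt d + wt e"
    and z: "\<And>e. e \<in> keys z \<Longrightarrow> \<mu> \<le> wt e" and b: "b \<in> keys z" "wt b = \<mu>"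
  shows "\<exists>e\<in>keys (z ^ n). wt e = of_nat n * \<mu>"
proof -
  define y where "y = (\<Sum>e\<in>{e \<in> keys z. wt e = \<mu>}. Poly_Mapping.single e (lookup z e))"
  have y: "lookup y e = (if wt e = \<mu> then lookup z e else 0)" for e
    unfolding y_def by (auto simp: lookup_sum lookup_single when_def in_keys_iff sum.delta)
  have y_keys: "wt e = \<mu>" if "e \<in> keys y" for e
    using that by (auto simp: in_keys_iff y split: if_splits)
  have "y \<noteq> 0" using b by (metis in_keys_iff lookup_zero y)
  have diff: "\<mu> < wt e" if "e \<in> keys (z - y)" for e
    using that z[of e] by (auto simp: in_keys_iff lookup_minus y split: if_splits)
  have rest: "of_nat n * \<mu> < wt e" if "e \<in> keys (z ^ n - y ^ n)" for n e
    using that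
  proof (induction n arbitrary: e)
    case (Suc n)
    have eq: "z ^ Suc n - y ^ Suc n = z * (z ^ n - y ^ n) + (z - y) * y ^ n"
      by (simp add: algebra_simps)
    have "e \<in> keys (z * (z ^ n - y ^ n)) \<union> keys ((z - y) * y ^ n)"
      by (rule subsetD[OF Poly_Mapping.keys_add Suc.prems[unfolded eq]])
    then have "e \<in> keys (z * (z ^ n - y ^ n)) \<or> e \<in> keys ((z - y) * y ^ n)" by simp
    then show ?case
    proof
      assume "e \<in> keys (z * (z ^ n - y ^ n))"
      then obtain c d where cd: "e = c + d" "c \<in> keys z" "d \<in> keys (z ^ n - y ^ n)"
        using keys_mult by blast
      show ?thesis using z[OF cd(2)] Suc.IH[OF cd(3)] by (simp add: cd(1) add algebra_simps)
    next
      assume "e \<in> keys ((z - y) * y ^ n)"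
      then obtain c d where cd: "e = c + d" "c \<in> keys (z - y)" "d \<in> keys (y ^ n)"
        using keys_mult by blast
      have "of_nat n * \<mu> \<le> wt d" using weight_ge_of_power[OF add _ cd(3), of \<mu>] y_keys by simp
      then show ?thesis using diff[OF cd(2)] by (simp add: cd(1) add algebra_simps)
    qed
  qed simp
  have "y ^ n \<noteq> 0" using \<open>y \<noteq> 0\<close> by simp
  then obtain e where e: "e \<in> keys (y ^ n)" by (metis all_not_in_conv keys_eq_empty)
  have ge: "of_nat n * \<mu> \<le> wt e" using weight_ge_of_power[OF add _ e, of \<mu>] y_keys by simp
  have le: "wt e \<le> of_nat n * \<mu>"
  proof -
    have "- of_nat n * \<mu> \<le> - wt e"
      using weight_ge_of_power[of "\<lambda>e. - wt e" y "- \<mu>" e n] add y_keys e by simp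
    then show ?thesis by simp
  qed
  have "e \<notin> keys (z ^ n - y ^ n)" using rest[of e n] le by auto
  then have "lookup (z ^ n) e = lookup (y ^ n) e" by (simp add: in_keys_iff lookup_minus)
  then have "e \<in> keys (z ^ n)" using e by (simp add: in_keys_iff)
  then show ?thesis using ge le by auto
qed

text \<open>
  A linear order on the variables orders the exponent vectors lexicographically, which makes the
  polynomials a domain.
\<close>

locale ordered_squarefree_generators = squarefree_generators V F q R I
  for V :: "'v::linorder set" and F and q and R :: "('v, 'k::field) mpoly ring" and I

begin

text \<open>
  Choose a separating weight for \<open>b\<close>: every monomial of \<open>I\<^sup>k\<close> has weight at least \<open>s k\<close>, while the
  least weight \<open>\<mu>\<close> of \<open>z\<close> is below \<open>s r\<close>. Weight \<open>d \<mu>\<close> occurs in \<open>z ^ d\<close>, but the other terms of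
  an integral equation have weight at least \<open>s r i + (d - i) \<mu> > d \<mu>\<close>.
\<close>

lemma frac_covers_if_integral:
  assumes z: "z \<in> integral_closure R (I [^]\<^bsub>ideals_set R\<^esub> r)" and b: "b \<in> keys z"
  shows "frac_covers F q r (lookup b)"
proof (rule ccontr)
  assume not: "\<not> frac_covers F q r (lookup b)"
  obtain w :: "'v \<Rightarrow> rat" and s where w: "\<And>v. w v \<ge> 0" and s: "\<And>j. j \<in> {1..q} \<Longrightarrow> s \<le> (\<Sum>v\<in>F j. w v)"
    and wb: "(\<Sum>v\<in>V. w v * of_nat (lookup b v)) < s * of_nat r"
    using separating_weight[OF finite_V F_sub not] by blast
  define wt where "wt e = (\<Sum>v\<in>V. w v * of_nat (lookup e v))" for e
  have wt_add: "wt (d + e) = wt d + wt e" for d e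
    unfolding wt_def by (simp add: lookup_add distrib_left sum.distrib)
  have wt_covers: "s * of_nat k \<le> wt e" if cov: "covers F q k (lookup e)" for k e
  proof -
    obtain a where a: "(\<Sum>j\<in>{1..q}. a j) = k" "\<And>v. load F q a v \<le> lookup e v"
      using cov unfolding covers_def by blast
    have "s * of_nat k = (\<Sum>j\<in>{1..q}. of_nat (a j) * s)"
      unfolding a(1)[symmetric] by (simp add: sum_distrib_left mult.commute)
    also have "\<dots> \<le> (\<Sum>j\<in>{1..q}. of_nat (a j) * (\<Sum>v\<in>F j. w v))"
      using s by (intro sum_mono mult_left_mono) auto
    also have "\<dots> = (\<Sum>j\<in>{1..q}. \<Sum>v\<in>{v \<in> V. v \<in> F j}. of_nat (a j) * w v)"
    proof (intro sum.cong refl)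
      fix j assume "j \<in> {1..q}"
      then have "{v \<in> V. v \<in> F j} = F j" using F_sub by blast
      then show "of_nat (a j) * (\<Sum>v\<in>F j. w v) = (\<Sum>v\<in>{v \<in> V. v \<in> F j}. of_nat (a j) * w v)"
        by (simp add: sum_distrib_left)
    qed
    also have "\<dots> = (\<Sum>v\<in>V. \<Sum>j\<in>{j \<in> {1..q}. v \<in> F j}. of_nat (a j) * w v)"
      by (rule sum.swap_restrict) (simp_all add: finite_V)
    also have "\<dots> = (\<Sum>v\<in>V. w v * of_nat (load F q a v))"
      unfolding load_def by (simp add: sum_distrib_left mult.commute)
    also have "\<dots> \<le> wt e"
      unfolding wt_def using a(2) w by (intro sum_mono mult_left_mono) auto
    finally show ?thesis .
  qed
  obtain d a where d: "d \<ge> 1" and a: "\<And>i. i \<in> {1..d} \<Longrightarrow> a i \<in> I [^]\<^bsub>ideals_set R\<^esub> (r * i)"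
    and eq: "z ^ d + (\<Sum>i\<in>{1..d}. a i * z ^ (d - i)) = 0"
    using z unfolding integral_closure_power_iff by blast
  define \<mu> where "\<mu> = Min (wt ` keys z)"
  have \<mu>: "\<mu> \<le> wt e" if "e \<in> keys z" for e using that unfolding \<mu>_def by simp
  have "\<mu> \<in> wt ` keys z" unfolding \<mu>_def using b by (intro Min_in) auto
  then obtain c where "c \<in> keys z" "wt c = \<mu>" by blast
  then obtain e where e: "e \<in> keys (z ^ d)" "wt e = of_nat d * \<mu>"
    using weight_of_power_attained[of wt z \<mu> c d] wt_add \<mu> by blast
  have "z ^ d = - (\<Sum>i\<in>{1..d}. a i * z ^ (d - i))" using eq by (simp add: add_eq_0_iff2)
  then have "e \<in> keys (\<Sum>i\<in>{1..d}. a i * z ^ (d - i))" using e(1) by (simp add: in_keys_iff)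
  then obtain i where i: "i \<in> {1..d}" "e \<in> keys (a i * z ^ (d - i))"
    using keys_sum[of "\<lambda>i. a i * z ^ (d - i)" "{1..d}"] by blast
  then obtain e1 e2 where e12: "e = e1 + e2" "e1 \<in> keys (a i)" "e2 \<in> keys (z ^ (d - i))"
    using keys_mult by blast
  have "s * of_nat (r * i) \<le> wt e1"
    using a[OF i(1)] e12(2) unfolding I_power_eq_covers monomial_set_def by (intro wt_covers) blast
  moreover have "of_nat (d - i) * \<mu> \<le> wt e2"
    by (rule weight_ge_of_power[OF wt_add _ e12(3)]) (rule \<mu>)
  ultimately have "s * of_nat (r * i) + of_nat (d - i) * \<mu> \<le> of_nat d * \<mu>"
    using e(2) unfolding e12(1) wt_add by linarith
  moreover have "(of_nat d :: rat) = of_nat i + of_nat (d - i)"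
    unfolding of_nat_add[symmetric] using i(1) by simp
  ultimately have "s * of_nat (r * i) + of_nat (d - i) * \<mu> \<le> (of_nat i + of_nat (d - i)) * \<mu>"
    by (simp only:)
  then have "s * of_nat (r * i) \<le> of_nat i * \<mu>" unfolding distrib_right by linarith
  then have "of_nat i * (s * of_nat r) \<le> of_nat i * \<mu>" by (simp add: mult.commute mult.left_commute)
  then have "s * of_nat r \<le> \<mu>" using i(1) by simp
  then show False using wb \<mu>[OF b] unfolding wt_def by linarith
qed

text \<open>
  No load exceeds the total of the weights, so exponents above \<open>r\<close> and variables outside \<open>V\<close> carry no
  information. Only finitely many exponent vectors remain.
\<close>

lemma frac_covers_truncate:
  assumes "frac_covers F q r b"
  shows "frac_covers F q r (\<lambda>v. if v \<in> V then min (b v) r else 0)"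
proof -
  obtain N a where N: "N \<ge> 1" and a: "(\<Sum>j\<in>{1..q}. a j) = N * r" "\<And>v. load F q a v \<le> N * b v"
    using assms unfolding frac_covers_def covers_def by blast
  have "load F q a v \<le> N * (if v \<in> V then min (b v) r else 0)" for v
  proof (cases "v \<in> V")
    case True
    have "load F q a v \<le> N * r" using load_le_total[of F q a v] a(1) by simp
    then show ?thesis using a(2)[of v] True by (simp add: min_def)
  next
    case False
    then have "{j \<in> {1..q}. v \<in> F j} = {}" using F_sub by blast
    then show ?thesis unfolding load_def by (simp only: sum.empty)
  qed
  then have "covers F q (N * r) (\<lambda>v. N * (if v \<in> V then min (b v) r else 0))"
    using a(1) by (intro coversI)
  then show ?thesis using N unfolding frac_covers_def by blast
qed

lemma ideal_filtration_powers: "ideal_filtration (\<lambda>i. I [^]\<^bsub>ideals_set R\<^esub> (r * i))"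
proof
  fix i k :: nat and x y :: "('v, 'k) mpoly"
  let ?P = "\<lambda>i. I [^]\<^bsub>ideals_set R\<^esub> (r * i)"
  have id: "ideal (?P i) R" for i by (rule ideal_power)
  show "0 \<in> ?P i" using additive_subgroup.zero_closed[OF ideal.axioms(1)[OF id]] unfolding R by simp
  show "1 \<in> ?P 0" by (simp add: ideals_set_def R mpoly_ring_closed)
  assume x: "x \<in> ?P i"
  show "- x \<in> ?P i" using x unfolding I_power_eq_covers monomial_set_def by (simp add: mpoly_ring_closed)
  show "x + y \<in> ?P i" if "y \<in> ?P i"
    using additive_subgroup.a_closed[OF ideal.axioms(1)[OF id] x that] unfolding R by simp
  show "x * y \<in> ?P (i + k)" if y: "y \<in> ?P k"
  proof -
    have "covers F q (r * (i + k)) (lookup e)" if "e \<in> keys (x * y)" for e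
    proof -
      obtain c d where e: "e = c + d" "c \<in> keys x" "d \<in> keys y" using keys_mult[of x y] \<open>e \<in> _\<close> by blast
      then have "covers F q (r * i + r * k) (\<lambda>v. lookup c v + lookup d v)"
        using x y unfolding I_power_eq_covers monomial_set_def by (intro covers_add) blast+
      then show ?thesis by (simp add: e(1) lookup_add[abs_def] distrib_left)
    qed
    then show ?thesis
      using x y unfolding I_power_eq_covers monomial_set_def by (simp add: mpoly_ring_closed)
  qed
qed

text \<open>
  The finite set \<open>E\<close> of truncated exponents that are fractionally covered at level \<open>q\<close> generates a
  monomial ideal, and by \<open>frac_covers_split\<close> multiplication by \<open>f\<close> maps each generator into \<open>I\<^sup>r\<close>
  times this ideal.
\<close>

lemma integral_if_frac_covers:
  assumes f: "f \<in> carrier R" and frac: "\<And>b. b \<in> keys f \<Longrightarrow> frac_covers F q r (lookup b)"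
  shows "f \<in> integral_closure R (I [^]\<^bsub>ideals_set R\<^esub> r)"
proof -
  define E where "E = exponent_of V ` {b \<in> V \<rightarrow>\<^sub>E {..q}. frac_covers F q q (lookup (exponent_of V b))}"
  define P where "P = I [^]\<^bsub>ideals_set R\<^esub> r"
  have "finite E" unfolding E_def by (intro finite_imageI finite_subset[OF _ finite_PiE[OF finite_V]]) auto
  have below: "\<exists>e\<in>E. \<forall>v. lookup e v \<le> lookup d v" if d: "frac_covers F q q (lookup d)" for d
  proof -
    define b where "b = restrict (\<lambda>v. min (lookup d v) q) V"
    have lb: "lookup (exponent_of V b) v = (if v \<in> V then min (lookup d v) q else 0)" for v
      unfolding b_def by (simp add: lookup_exponent_of finite_V)
    have "frac_covers F q q (lookup (exponent_of V b))"
      using frac_covers_truncate[OF d] unfolding lb[abs_def] .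
    moreover have "b \<in> V \<rightarrow>\<^sub>E {..q}" unfolding b_def by auto
    ultimately have "exponent_of V b \<in> E" unfolding E_def by blast
    then show ?thesis using lb by (intro bexI[of _ "exponent_of V b"]) auto
  qed
  have E_frac: "frac_covers F q q (lookup e)" "keys e \<subseteq> V" if "e \<in> E" for e
    using that keys_exponent_of[OF finite_V] unfolding E_def by auto
  \<comment> \<open>\<open>E\<close> is not empty: it lies below the constant exponent \<open>q\<close>, which is covered by all generators once\<close>
  have "frac_covers F q q (lookup (exponent_of V (\<lambda>_. q)))"
  proof (rule frac_covers_mono[OF covers_imp_frac_covers])
    show "covers F q q (load F q (\<lambda>_. 1))" by (rule coversI[where a = "\<lambda>_. 1"]) auto
    fix v
    show "load F q (\<lambda>_. 1) v \<le> lookup (exponent_of V (\<lambda>_. q)) v"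
    proof (cases "v \<in> V")
      case True
      then show ?thesis using load_le_total[of F q "\<lambda>_. 1" v] by (simp add: lookup_exponent_of finite_V)
    next
      case False
      then have "{j \<in> {1..q}. v \<in> F j} = {}" using F_sub by blast
      then show ?thesis unfolding load_def by (simp only: sum.empty)
    qed
  qed
  from below[OF this] obtain e0 where "e0 \<in> E" by blast
  have step: "\<exists>M. (\<forall>y\<in>E. M y \<in> P) \<and> f * xpow e = (\<Sum>y\<in>E. M y * xpow y)" if e: "e \<in> E" for e
  proof -
    have "\<exists>y\<in>E. \<exists>m\<in>P. Poly_Mapping.single b (lookup f b) * xpow e = m * xpow y" if b: "b \<in> keys f" for b
    proof -
      have "frac_covers F q (r + q) (\<lambda>v. lookup b v + lookup e v)"
        by (intro frac_covers_add frac[OF b] E_frac(1)[OF e])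
      then obtain a where a: "(\<Sum>j\<in>{1..q}. a j) = r" "\<And>v. load F q a v \<le> lookup b v + lookup e v"
        "frac_covers F q q (\<lambda>v. lookup b v + lookup e v - load F q a v)"
        by (rule frac_covers_split) blast
      define g where "g = exponent_of V (load F q a)"
      have g: "lookup g v = load F q a v" for v
      proof (cases "v \<in> V")
        case False
        then have "{j \<in> {1..q}. v \<in> F j} = {}" using F_sub by blast
        then show ?thesis using False unfolding load_def g_def
          by (simp only: sum.empty lookup_exponent_of[OF finite_V] if_False)
      qed (simp add: g_def lookup_exponent_of finite_V)
      have be: "b + e = g + (b + e - g)"
        using a(2) by (intro exponent_minus_add) (simp add: g lookup_add)
      have "frac_covers F q q (lookup (b + e - g))"
        using a(3) by (simp add: lookup_minus[abs_def] lookup_add g)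
      from below[OF this] obtain y where y: "y \<in> E" "\<And>v. lookup y v \<le> lookup (b + e - g) v" by blast
      have beg: "b + e - g = y + (b + e - g - y)" by (rule exponent_minus_add) (rule y(2))
      define h where "h = g + (b + e - g - y)"
      have bey: "b + e = h + y" unfolding h_def using be beg by (metis add.assoc add.commute)
      have "keys h \<subseteq> keys (b + e)" unfolding bey by (auto simp: in_keys_iff lookup_add)
      also have "\<dots> \<subseteq> keys b \<union> keys e" by (rule Poly_Mapping.keys_add)
      also have "\<dots> \<subseteq> V" using b f E_frac(2)[OF e] unfolding R mpoly_ring_carrier by blast
      finally have "keys h \<subseteq> V" .
      moreover have "covers F q r (lookup h)"
        using a(1) by (rule coversI) (simp add: h_def lookup_add g)
      ultimately have "Poly_Mapping.single h (lookup f b) \<in> P"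
        unfolding P_def I_power_eq_covers monomial_set_def by (simp add: mpoly_ring_carrier)
      moreover have "Poly_Mapping.single b (lookup f b) * xpow e = Poly_Mapping.single h (lookup f b) * xpow y"
        by (simp add: mult_single bey)
      ultimately show ?thesis using y(1) by blast
    qed
    then obtain y m where ym: "\<And>b. b \<in> keys f \<Longrightarrow> y b \<in> E \<and> m b \<in> P \<and>
        Poly_Mapping.single b (lookup f b) * xpow e = m b * xpow (y b)"
      by metis
    \<comment> \<open>collect the terms of \<open>f\<close> that are sent to the same generator\<close>
    define M where "M x = (\<Sum>b\<in>{b \<in> keys f. y b = x}. m b)" for x
    have "M x \<in> P" for x
      unfolding M_def P_def using ym ideal_power[of r] unfolding P_def R by (intro ideal_sum_closed) auto
    moreover have "f * xpow e = (\<Sum>x\<in>E. M x * xpow x)"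
    proof -
      have "f * xpow e = (\<Sum>b\<in>keys f. Poly_Mapping.single b (lookup f b) * xpow e)"
        by (subst sum_of_monomials[of f]) (simp add: sum_distrib_right)
      also have "\<dots> = (\<Sum>b\<in>keys f. m b * xpow (y b))" using ym by (intro sum.cong) auto
      also have "\<dots> = (\<Sum>x\<in>E. \<Sum>b\<in>{b \<in> keys f. y b = x}. m b * xpow (y b))"
        using ym \<open>finite E\<close> by (intro sum.group[symmetric]) auto
      also have "\<dots> = (\<Sum>x\<in>E. M x * xpow x)"
        unfolding M_def sum_distrib_right by (intro sum.cong) auto
      finally show ?thesis .
    qed
    ultimately show ?thesis by blast
  qed
  then have "\<forall>e\<in>E. \<exists>M. (\<forall>y\<in>E. M y \<in> P) \<and> f * xpow e = (\<Sum>y\<in>E. M y * xpow y)" by blast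
  from bchoice[OF this] obtain M where
    M: "\<And>e. e \<in> E \<Longrightarrow> (\<forall>y\<in>E. M e y \<in> P) \<and> f * xpow e = (\<Sum>y\<in>E. M e y * xpow y)" by blast
  let ?x = "xpow :: _ \<Rightarrow> ('v, 'k) mpoly"
  have inj: "inj_on ?x E"
  proof (rule inj_onI)
    fix e e' :: "'v \<Rightarrow>\<^sub>0 nat" assume "?x e = ?x e'"
    then have "keys (?x e) = keys (?x e')" by simp
    then show "e = e'" by simp
  qed
  define ix where "ix = inv_into E ?x"
  have ix: "ix (?x e) = e" if "e \<in> E" for e unfolding ix_def using inj that by (rule inv_into_f_f)
  have "\<exists>d\<ge>1. \<exists>a. (\<forall>i\<in>{1..d}. a i \<in> I [^]\<^bsub>ideals_set R\<^esub> (r * i)) \<and>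
      f ^ d + (\<Sum>i\<in>{1..d}. a i * f ^ (d - i)) = 0"
  proof (rule integral_equation_if_stable_module[OF ideal_filtration_powers,
        where G = "?x ` E" and g = "?x e0" and M = "\<lambda>x y. M (ix x) (ix y)"])
    show "finite (?x ` E)" using \<open>finite E\<close> by simp
    show "?x e0 \<in> ?x ` E" using \<open>e0 \<in> E\<close> by simp
    show "?x e0 \<noteq> 0" 
    proof
      assume "?x e0 = 0"
      then have "keys (?x e0) = {}" by simp
      then show False by simp
    qed
    show "M (ix x) (ix y) \<in> I [^]\<^bsub>ideals_set R\<^esub> (r * 1)" if "x \<in> ?x ` E" "y \<in> ?x ` E" for x y
      using that M ix unfolding P_def by auto
    show "f * x = (\<Sum>y\<in>?x ` E. M (ix x) (ix y) * y)" if x: "x \<in> ?x ` E" for x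
    proof -
      obtain e where e: "e \<in> E" "x = ?x e" using x by blast
      have "(\<Sum>y\<in>?x ` E. M (ix x) (ix y) * y) = (\<Sum>y\<in>E. M e y * ?x y)"
        unfolding sum.reindex[OF inj] e(2) using ix e(1) by (intro sum.cong) auto
      then show ?thesis using M[OF e(1)] e(2) by simp
    qed
  qed
  then show ?thesis using f unfolding integral_closure_power_iff by blast
qed

theorem integral_closure_power_eq:
  "integral_closure R (I [^]\<^bsub>ideals_set R\<^esub> r) = monomial_set V (frac_covers F q r)"
proof
  show "integral_closure R (I [^]\<^bsub>ideals_set R\<^esub> r) \<subseteq> monomial_set V (frac_covers F q r)"
  proof
    fix z assume z: "z \<in> integral_closure R (I [^]\<^bsub>ideals_set R\<^esub> r)"
    then have "z \<in> carrier (mpoly_ring V)" unfolding integral_closure_def R by simp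
    then show "z \<in> monomial_set V (frac_covers F q r)"
      using frac_covers_if_integral[OF z] unfolding monomial_set_def by simp
  qed
  show "monomial_set V (frac_covers F q r) \<subseteq> integral_closure R (I [^]\<^bsub>ideals_set R\<^esub> r)"
  proof
    fix z :: "('v, 'k) mpoly" assume "z \<in> monomial_set V (frac_covers F q r)"
    then have "z \<in> carrier R" "\<And>b. b \<in> keys z \<Longrightarrow> frac_covers F q r (lookup b)"
      unfolding monomial_set_def R by simp_all
    then show "z \<in> integral_closure R (I [^]\<^bsub>ideals_set R\<^esub> r)" by (rule integral_if_frac_covers)
  qed
qed

lemma power_subset_integral_closure:
  "I [^]\<^bsub>ideals_set R\<^esub> (r::nat) \<subseteq> integral_closure R (I [^]\<^bsub>ideals_set R\<^esub> r)"
  unfolding integral_closure_power_eq unfolding I_power_eq_covers monomial_set_def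
  using covers_imp_frac_covers by blast

lemma power_integrally_closed_iff:
  "integral_closure R (I [^]\<^bsub>ideals_set R\<^esub> r) = I [^]\<^bsub>ideals_set R\<^esub> r \<longleftrightarrow>
    (\<forall>b. frac_covers F q r b \<longrightarrow> covers F q r b)"
proof
  assume closed: "integral_closure R (I [^]\<^bsub>ideals_set R\<^esub> r) = I [^]\<^bsub>ideals_set R\<^esub> r"
  show "\<forall>b. frac_covers F q r b \<longrightarrow> covers F q r b"
  proof (intro allI impI)
    fix b assume b: "frac_covers F q r b"
    let ?e = "exponent_of V (\<lambda>v. min (b v) r)"
    have e: "lookup ?e = (\<lambda>v. if v \<in> V then min (b v) r else 0)"
      by (auto simp: lookup_exponent_of finite_V)
    have ke: "keys ?e \<subseteq> V" by (rule keys_exponent_of[OF finite_V])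
    have "xpow ?e \<in> integral_closure R (I [^]\<^bsub>ideals_set R\<^esub> r)"
      using frac_covers_truncate[OF b] unfolding e[symmetric] by (rule xpow_integral[OF ke])
    then have "xpow ?e \<in> I [^]\<^bsub>ideals_set R\<^esub> r" by (simp only: closed)
    then have "covers F q r (lookup ?e)" unfolding xpow_in_power_iff[OF ke] .
    then show "covers F q r b" by (rule covers_mono) (simp add: e)
  qed
next
  assume "\<forall>b. frac_covers F q r b \<longrightarrow> covers F q r b"
  then show "integral_closure R (I [^]\<^bsub>ideals_set R\<^esub> r) = I [^]\<^bsub>ideals_set R\<^esub> r"
    using power_subset_integral_closure unfolding integral_closure_power_eq
    unfolding I_power_eq_covers monomial_set_def by blast
qed

end

section \<open>Greatest common divisors and least common multiples of squarefree monomials\<close>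

lemma xpow_divides_iff:
  fixes p :: "('v, 'k::comm_ring_1) mpoly"
  assumes p: "p \<in> carrier (mpoly_ring V)"
  shows "xpow d divides\<^bsub>mpoly_ring V\<^esub> p \<longleftrightarrow> (\<forall>e\<in>keys p. \<forall>v. lookup d v \<le> lookup e v)"
proof
  assume "xpow d divides\<^bsub>mpoly_ring V\<^esub> p"
  then obtain c where c: "p = xpow d * c" unfolding factor_def by auto
  show "\<forall>e\<in>keys p. \<forall>v. lookup d v \<le> lookup e v"
  proof
    fix e assume "e \<in> keys p"
    then obtain e' where "e = d + e'" using keys_mult[of "xpow d" c] c by auto
    then show "\<forall>v. lookup d v \<le> lookup e v" by (simp add: lookup_add)
  qed
next
  assume le: "\<forall>e\<in>keys p. \<forall>v. lookup d v \<le> lookup e v"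
  define c where "c = (\<Sum>e\<in>keys p. Poly_Mapping.single (e - d) (lookup p e))"
  have "xpow d * c = (\<Sum>e\<in>keys p. Poly_Mapping.single e (lookup p e))"
    unfolding c_def sum_distrib_left
    using le by (intro sum.cong refl) (simp add: mult_single exponent_minus_add[symmetric])
  then have "p = xpow d * c" using sum_of_monomials[of p] by simp
  moreover have "c \<in> carrier (mpoly_ring V)"
    unfolding c_def
  proof (rule mpoly_ring_sum_closed)
    fix e assume "e \<in> keys p"
    moreover have "keys (e - d) \<subseteq> keys e" by (auto simp: in_keys_iff lookup_minus)
    ultimately show "Poly_Mapping.single (e - d) (lookup p e) \<in> carrier (mpoly_ring V)"
      using p unfolding mpoly_ring_carrier by auto
  qed
  ultimately show "xpow d divides\<^bsub>mpoly_ring V\<^esub> p" unfolding factor_def by auto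
qed

text \<open>
  A sum of exponents that arises in only one way cannot cancel in a product.
\<close>

lemma unique_sum_in_keys_mult:
  fixes y c :: "('v, 'k::idom) mpoly"
  assumes s: "s \<in> keys y" and t: "t \<in> keys c"
    and uniq: "\<And>s' t'. s' \<in> keys y \<Longrightarrow> t' \<in> keys c \<Longrightarrow> s' + t' = s + t \<Longrightarrow> s' = s \<and> t' = t"
  shows "s + t \<in> keys (y * c)"
proof -
  define y' where "y' = y - Poly_Mapping.single s (lookup y s)"
  define c' where "c' = c - Poly_Mapping.single t (lookup c t)"
  have ky: "keys y' \<subseteq> keys y - {s}" and kc: "keys c' \<subseteq> keys c - {t}"
    unfolding y'_def c'_def by (auto simp: in_keys_iff lookup_minus lookup_single when_def split: if_splits)
  have eq: "y * c = Poly_Mapping.single (s + t) (lookup y s * lookup c t)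
      + (Poly_Mapping.single s (lookup y s) * c' + y' * c)"
    unfolding y'_def c'_def mult_single[symmetric] by (simp add: algebra_simps)
  have "s + t \<notin> keys (Poly_Mapping.single s (lookup y s) * c')"
  proof
    assume "s + t \<in> keys (Poly_Mapping.single s (lookup y s) * c')"
    then obtain s' t' where "s + t = s' + t'" "s' \<in> keys (Poly_Mapping.single s (lookup y s))" "t' \<in> keys c'"
      using keys_mult by blast
    then show False using kc by (auto split: if_splits)
  qed
  moreover have "s + t \<notin> keys (y' * c)"
  proof
    assume "s + t \<in> keys (y' * c)"
    then obtain s' t' where "s + t = s' + t'" "s' \<in> keys y'" "t' \<in> keys c" using keys_mult by blast
    then show False using ky uniq[of s' t'] by auto
  qed
  ultimately have "lookup (y * c) (s + t) = lookup y s * lookup c t"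
    unfolding eq by (simp add: lookup_add in_keys_iff)
  then show ?thesis using s t by (simp add: in_keys_iff)
qed

text \<open>
  The largest and the smallest exponents of two factors both survive in the product; if the
  product has only one exponent, they coincide.
\<close>

lemma factor_of_monomial:
  fixes y c :: "('v::linorder, 'k::idom) mpoly"
  assumes yc: "y * c = xpow e"
  obtains d u where "y = Poly_Mapping.single d u" "u \<noteq> 0"
proof -
  have "y \<noteq> 0" "c \<noteq> 0"
  proof -
    have "keys (y * c) \<noteq> {}" unfolding yc by simp
    then show "y \<noteq> 0" "c \<noteq> 0" by auto
  qed
  then have ne: "keys y \<noteq> {}" "keys c \<noteq> {}" by auto
  have "Max (keys y) + Max (keys c) \<in> keys (y * c)"
  proof (rule unique_sum_in_keys_mult)
    fix s t assume st: "s \<in> keys y" "t \<in> keys c" "s + t = Max (keys y) + Max (keys c)"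
    have "s \<le> Max (keys y)" "t \<le> Max (keys c)" using st by simp_all
    then show "s = Max (keys y) \<and> t = Max (keys c)"
      using st(3) by (metis add_le_less_mono add_less_le_mono order.not_eq_order_implies_strict order_less_irrefl)
  qed (use ne in simp_all)
  moreover have "Min (keys y) + Min (keys c) \<in> keys (y * c)"
  proof (rule unique_sum_in_keys_mult)
    fix s t assume st: "s \<in> keys y" "t \<in> keys c" "s + t = Min (keys y) + Min (keys c)"
    have "Min (keys y) \<le> s" "Min (keys c) \<le> t" using st by simp_all
    then show "s = Min (keys y) \<and> t = Min (keys c)"
      using st(3) by (metis add_le_less_mono add_less_le_mono order.not_eq_order_implies_strict order_less_irrefl)
  qed (use ne in simp_all)
  ultimately have eq: "Max (keys y) + Max (keys c) = Min (keys y) + Min (keys c)"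
    unfolding yc by simp
  have "Min (keys y) \<le> Max (keys y)" "Min (keys c) \<le> Max (keys c)" using ne by simp_all
  then have mm: "Min (keys y) = Max (keys y)"
    using eq by (metis add_less_le_mono order.not_eq_order_implies_strict order_less_irrefl)
  have "s = Max (keys y)" if "s \<in> keys y" for s
    using Min_le[OF _ that] Max_ge[OF _ that] mm by (simp add: antisym)
  then have "keys y = {Max (keys y)}" using ne by auto
  then obtain d where d: "keys y = {d}" by blast
  have "y = Poly_Mapping.single d (lookup y d)" using sum_of_monomials[of y] unfolding d by simp
  moreover have "lookup y d \<noteq> 0" using d by (simp add: in_keys_iff[symmetric])
  ultimately show ?thesis using that by blast
qed

context
  fixes V :: "'v::linorder set" and R :: "('v, 'k::field) mpoly ring"
  assumes V: "finite V" and R: "R = mpoly_ring V"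

begin

lemma sqf_closed: "A \<subseteq> V \<Longrightarrow> sqf A \<in> carrier R"
  unfolding R using keys_exponent_of[of A] finite_subset[OF _ V] by (blast intro: xpow_closed)

lemma lookup_sqf_exponent: "A \<subseteq> V \<Longrightarrow> lookup (exponent_of A (\<lambda>_. 1)) v = of_bool (v \<in> A)"
  using finite_subset[OF _ V] by (simp add: lookup_exponent_of)

lemma sqf_divides_sqf_iff:
  assumes "A \<subseteq> V" "B \<subseteq> V"
  shows "sqf A divides\<^bsub>R\<^esub> sqf B \<longleftrightarrow> A \<subseteq> B"
  using sqf_closed[OF assms(2)] unfolding R
  by (subst xpow_divides_iff) (auto simp: lookup_sqf_exponent[simplified] assms)

text \<open>
  A common divisor divides a monomial, hence is itself a scalar multiple of a monomial, and then
  only exponents need to be compared.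
\<close>

lemma gcdof_sqf:
  assumes A: "A \<subseteq> V" and B: "B \<subseteq> V"
  shows "sqf (A \<inter> B) gcdof\<^bsub>R\<^esub> (sqf A) (sqf B)"
  unfolding isgcd_def
proof (intro conjI ballI impI)
  show "sqf (A \<inter> B) divides\<^bsub>R\<^esub> sqf A" "sqf (A \<inter> B) divides\<^bsub>R\<^esub> sqf B"
    using A B by (subst sqf_divides_sqf_iff; blast)+
  fix y assume y: "y \<in> carrier R" and "y divides\<^bsub>R\<^esub> sqf A \<and> y divides\<^bsub>R\<^esub> sqf B"
  then obtain c c' where "sqf A = y * c" "sqf B = y * c'"
    unfolding R factor_def mpoly_ring_simps by blast
  then have c: "y * c = sqf A" and c': "y * c' = sqf B" by (simp_all only:)
  from c obtain d u where y_eq: "y = Poly_Mapping.single d u" and u: "u \<noteq> 0"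
    by (rule factor_of_monomial)
  have le: "lookup d v \<le> lookup e v" if "y * c = xpow e" for c e v
  proof -
    have "e \<in> keys (y * c)" unfolding that by simp
    then obtain e' where "e = d + e'" using keys_mult[of y c] unfolding y_eq by (auto split: if_splits)
    then show ?thesis by (simp add: lookup_add)
  qed
  let ?g = "exponent_of (A \<inter> B) (\<lambda>_. 1 :: nat)"
  have "A \<inter> B \<subseteq> V" using A by blast
  have "lookup d v \<le> lookup ?g v" for v
    using le[OF c, of v] le[OF c', of v]
    unfolding lookup_sqf_exponent[OF A] lookup_sqf_exponent[OF B] lookup_sqf_exponent[OF \<open>A \<inter> B \<subseteq> V\<close>]
    by (auto split: if_splits)
  then have g: "?g = d + (?g - d)" by (rule exponent_minus_add)
  have "keys (?g - d) \<subseteq> keys ?g" by (auto simp: in_keys_iff lookup_minus)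
  also have "\<dots> \<subseteq> V" using keys_exponent_of[of "A \<inter> B"] finite_subset[OF \<open>A \<inter> B \<subseteq> V\<close> V] \<open>A \<inter> B \<subseteq> V\<close> by blast
  finally have "Poly_Mapping.single (?g - d) (inverse u) \<in> carrier R"
    unfolding R mpoly_ring_carrier by simp
  moreover have "sqf (A \<inter> B) = y * Poly_Mapping.single (?g - d) (inverse u)"
    unfolding y_eq mult_single g[symmetric] using u by simp
  ultimately show "y divides\<^bsub>R\<^esub> sqf (A \<inter> B)"
    unfolding factor_def R mpoly_ring_simps by blast
qed

lemma lcmof_sqf:
  assumes A: "A \<subseteq> V" and B: "B \<subseteq> V"
  shows "sqf (A \<union> B) lcmof\<^bsub>R\<^esub> (sqf A) (sqf B)"
  unfolding islcm_def
proof (intro conjI ballI impI)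
  have AB: "A \<union> B \<subseteq> V" using A B by blast
  show "sqf A divides\<^bsub>R\<^esub> sqf (A \<union> B)" "sqf B divides\<^bsub>R\<^esub> sqf (A \<union> B)"
    using A B AB by (subst sqf_divides_sqf_iff; blast)+
  fix y assume y: "y \<in> carrier R" and "sqf A divides\<^bsub>R\<^esub> y \<and> sqf B divides\<^bsub>R\<^esub> y"
  then have d: "sqf A divides\<^bsub>R\<^esub> y" "sqf B divides\<^bsub>R\<^esub> y" by blast+
  show "sqf (A \<union> B) divides\<^bsub>R\<^esub> y"
    using d unfolding R xpow_divides_iff[OF y[unfolded R]]
      lookup_sqf_exponent[OF A] lookup_sqf_exponent[OF B] lookup_sqf_exponent[OF AB] by force
qed

text \<open>
  Any choice of gcd and lcm is associated to the squarefree monomials on \<open>A \<inter> B\<close> and on \<open>C \<union> D\<close>.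
\<close>

lemma somegcd_divides_somelcm_iff:
  assumes A: "A \<subseteq> V" and B: "B \<subseteq> V" and C: "C \<subseteq> V" and D: "D \<subseteq> V"
  shows "somegcd R (sqf A) (sqf B) divides\<^bsub>R\<^esub> somelcm R (sqf C) (sqf D) \<longleftrightarrow> A \<inter> B \<subseteq> C \<union> D"
proof -
  interpret cring R unfolding R by (rule cring_mpoly_ring)
  let ?g = "somegcd R (sqf A) (sqf B)" and ?l = "somelcm R (sqf C) (sqf D)"
  have AB: "A \<inter> B \<subseteq> V" and CD: "C \<union> D \<subseteq> V" using assms by blast+
  have g: "?g \<in> carrier R \<and> ?g gcdof\<^bsub>R\<^esub> (sqf A) (sqf B)"
    unfolding somegcd_def by (rule someI[of _ "sqf (A \<inter> B)"]) (intro conjI sqf_closed[OF AB] gcdof_sqf[OF A B])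
  have l: "?l \<in> carrier R \<and> ?l lcmof\<^bsub>R\<^esub> (sqf C) (sqf D)"
    unfolding somelcm_def by (rule someI[of _ "sqf (C \<union> D)"]) (intro conjI sqf_closed[OF CD] lcmof_sqf[OF C D])
  have 1: "?g divides\<^bsub>R\<^esub> sqf (A \<inter> B)" "sqf (A \<inter> B) divides\<^bsub>R\<^esub> ?g"
    using g gcdof_sqf[OF A B] sqf_closed[OF AB] unfolding isgcd_def by blast+
  have 2: "?l divides\<^bsub>R\<^esub> sqf (C \<union> D)" "sqf (C \<union> D) divides\<^bsub>R\<^esub> ?l"
    using l lcmof_sqf[OF C D] sqf_closed[OF CD] unfolding islcm_def by blast+
  have "?g divides\<^bsub>R\<^esub> ?l \<longleftrightarrow> sqf (A \<inter> B) divides\<^bsub>R\<^esub> sqf (C \<union> D)"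
  proof
    assume "?g divides\<^bsub>R\<^esub> ?l"
    from divides_trans[OF divides_trans[OF 1(2) this sqf_closed[OF AB]] 2(1) sqf_closed[OF AB]]
    show "sqf (A \<inter> B) divides\<^bsub>R\<^esub> sqf (C \<union> D)" .
  next
    assume *: "sqf (A \<inter> B) divides\<^bsub>R\<^esub> sqf (C \<union> D)"
    have gc: "?g \<in> carrier R" using g by blast
    from divides_trans[OF divides_trans[OF 1(1) * gc] 2(2) gc] show "?g divides\<^bsub>R\<^esub> ?l" .
  qed
  then show ?thesis using sqf_divides_sqf_iff[OF AB CD] by simp
qed

end

section \<open>Comparison with the extremal ideal\<close>

lemma mp_subst_power: "mp_subst f (p ^ n) = mp_subst f p ^ n"
proof (induction n)
  case 0
  show ?case using mp_subst_const[of f 1] by (simp add: mp_const_arith)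
qed (simp add: mp_subst_mult)

lemma set_add_memI:
  assumes "R = mpoly_ring V" "x \<in> P" "y \<in> L"
  shows "x + y \<in> P <+>\<^bsub>R\<^esub> L"
  using assms unfolding set_add_def' by auto

lemma set_add_subset_ideal:
  assumes C: "ideal C R" and "P \<subseteq> C" "L \<subseteq> C"
  shows "P <+>\<^bsub>R\<^esub> L \<subseteq> C"
  using assms additive_subgroup.a_closed[OF ideal.axioms(1)[OF C]] unfolding set_add_def' by auto

text \<open>
  The index sets of the extremal variables are the possible types of variables of \<open>R\<close>; the type of
  \<open>k\<close> is the set of generators divisible by the variable \<open>k\<close>.
\<close>

locale extremal_comparison =
  fixes n q :: nat and F :: "nat \<Rightarrow> nat set" and m :: "nat \<Rightarrow> (nat, 'k::field) mpoly"
    and R :: "(nat, 'k) mpoly ring" and I :: "(nat, 'k) mpoly set"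
    and S :: "(nat set, 'k) mpoly ring"
  assumes F: "\<And>j. j \<in> {1..q} \<Longrightarrow> F j \<subseteq> {1..n}"
    and m: "\<And>j. j \<in> {1..q} \<Longrightarrow> m j = (\<Prod>v\<in>F j. mp_var v)"
    and R: "R = mpoly_ring {1..n}" and I: "I = Idl\<^bsub>R\<^esub> (m ` {1..q})"
    and S: "S = extremal_ring q"

begin

abbreviation "sets \<equiv> Pow {1..q} - {{}}"

abbreviation "sets_containing i \<equiv> {A. A \<subseteq> {1..q} \<and> i \<in> A}"

sublocale I: ordered_squarefree_generators "{1..n}" F q R I
proof
  show "I = Idl\<^bsub>R\<^esub> ((\<lambda>j. \<Prod>v\<in>F j. mp_var v) ` {1..q})"
    unfolding I using m by (intro arg_cong[where f = "genideal R"] image_cong) auto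
qed (use F R in auto)

sublocale E: squarefree_generators sets sets_containing q S "extremal_ideal q"
proof
  show "extremal_ideal q = Idl\<^bsub>S\<^esub> ((\<lambda>j. \<Prod>v\<in>sets_containing j. mp_var v) ` {1..q})"
    unfolding extremal_ideal_def S extremal_gen_def ..
qed (auto simp: S extremal_ring_def)

definition type_of :: "nat \<Rightarrow> nat set" where
  "type_of k = {j \<in> {1..q}. k \<in> F j}"

text \<open>
  This is why the extremal ideal controls all others: the load of a variable depends only on
  its type.
\<close>

lemma load_extremal: "load sets_containing q a (type_of k) = load F q a k"
proof -
  have "{j \<in> {1..q}. type_of k \<in> sets_containing j} = {j \<in> {1..q}. k \<in> F j}"
    unfolding type_of_def by auto
  then show ?thesis unfolding load_def by (simp only:)
qed

lemma load_outside: "k \<notin> {1..n} \<Longrightarrow> load F q a k = 0"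
proof -
  assume "k \<notin> {1..n}"
  then have "{j \<in> {1..q}. k \<in> F j} = {}" using F by blast
  then show ?thesis unfolding load_def by (simp only: sum.empty)
qed

lemma load_extremal_outside: "A \<notin> sets \<Longrightarrow> load sets_containing q a A = 0"
proof -
  assume "A \<notin> sets"
  then have "{j \<in> {1..q}. A \<in> sets_containing j} = {}" by blast
  then show ?thesis unfolding load_def by (simp only: sum.empty)
qed

lemma psi_var_eq:
  assumes "A \<subseteq> {1..q}"
  shows "psi_var n q m A = sqf {k \<in> {1..n}. type_of k = A}"
proof -
  have "mp_var k divides\<^bsub>R\<^esub> m j \<longleftrightarrow> k \<in> F j" if j: "j \<in> {1..q}" for k j
  proof -
    have mj: "m j = sqf (F j)" unfolding m[OF j] prod_mp_var ..
    have "m j \<in> carrier (mpoly_ring {1..n})" using I.gen_closed[OF j] unfolding mj R .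
    from xpow_divides_iff[OF this, of "Poly_Mapping.single k 1"]
    have "mp_var k divides\<^bsub>R\<^esub> m j \<longleftrightarrow>
        (\<forall>v. lookup (Poly_Mapping.single k 1) v \<le> lookup (exponent_of (F j) (\<lambda>_. 1)) v)"
      unfolding mp_var_def R mj by simp
    also have "\<dots> \<longleftrightarrow> (\<forall>v. v = k \<longrightarrow> v \<in> F j)"
      unfolding lookup_exponent_of[OF I.finite_F[OF j]] lookup_single when_def
      by (intro all_cong1) auto
    finally show ?thesis by simp
  qed
  moreover have "(\<forall>j\<in>{1..q}. k \<in> F j \<longleftrightarrow> j \<in> A) \<longleftrightarrow> type_of k = A" for k
    using assms unfolding type_of_def by blast
  ultimately have "{k \<in> {1..n}. \<forall>j\<in>{1..q}. mp_var k divides\<^bsub>R\<^esub> m j \<longleftrightarrow> j \<in> A} = {k \<in> {1..n}. type_of k = A}"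
    by simp
  then show ?thesis unfolding psi_var_def R[symmetric] prod_mp_var by simp
qed

text \<open>
  The exponent map underlying \<open>\<psi>\<close>. For exponents of the extremal ring, a variable of empty type
  gets exponent \<open>0\<close>, since the empty set is not an index there.
\<close>

definition pull :: "(nat set \<Rightarrow>\<^sub>0 nat) \<Rightarrow> nat \<Rightarrow>\<^sub>0 nat" where
  "pull e = exponent_of {1..n} (\<lambda>k. lookup e (type_of k))"

lemma lookup_pull: "lookup (pull e) k = (if k \<in> {1..n} then lookup e (type_of k) else 0)"
  unfolding pull_def by (simp add: lookup_exponent_of)

lemma keys_pull: "keys (pull e) \<subseteq> {1..n}"
  unfolding pull_def by (rule keys_exponent_of) simp

lemma psi_single:
  assumes e: "keys e \<subseteq> sets"
  shows "psi n q m (Poly_Mapping.single e c) = Poly_Mapping.single (pull e) c"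
proof -
  let ?x = "\<lambda>A. exponent_of {k \<in> {1..n}. type_of k = A} (\<lambda>_. 1 :: nat)"
  have "(\<Prod>A\<in>keys e. psi_var n q m A ^ lookup e A) = (\<Prod>A\<in>keys e. xpow (\<Sum>i<lookup e A. ?x A))"
    using e by (intro prod.cong refl) (simp add: psi_var_eq xpow_power subset_iff del: One_nat_def)
  also have "\<dots> = xpow (\<Sum>A\<in>keys e. \<Sum>i<lookup e A. ?x A)" by (rule xpow_prod)
  also have "(\<Sum>A\<in>keys e. \<Sum>i<lookup e A. ?x A) = pull e"
  proof (rule poly_mapping_eqI)
    fix k
    have "lookup (\<Sum>A\<in>keys e. \<Sum>i<lookup e A. ?x A) k =
        (\<Sum>A\<in>keys e. if A = type_of k then (if k \<in> {1..n} then lookup e A else 0) else 0)"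
      unfolding lookup_sum
      by (intro sum.cong refl) (auto simp: lookup_exponent_of)
    also have "\<dots> = lookup (pull e) k"
      unfolding lookup_pull by (simp add: sum.delta in_keys_iff)
    finally show "lookup (\<Sum>A\<in>keys e. \<Sum>i<lookup e A. ?x A) k = lookup (pull e) k" .
  qed
  finally show ?thesis
    unfolding psi_def mp_subst_single by (simp add: single_eq_const_mult[symmetric])
qed

lemma covers_pull:
  assumes "covers sets_containing q r (lookup e)"
  shows "covers F q r (lookup (pull e))"
proof -
  obtain a where a: "(\<Sum>j\<in>{1..q}. a j) = r" "\<And>A. load sets_containing q a A \<le> lookup e A"
    using assms unfolding covers_def by blast
  show ?thesis
  proof (rule coversI[OF a(1)])
    show "load F q a k \<le> lookup (pull e) k" for k
      using a(2)[of "type_of k"] load_outside[of k a] unfolding load_extremal lookup_pull by simp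
  qed
qed

lemma psi_power:
  assumes p: "p \<in> extremal_ideal q [^]\<^bsub>ideals_set S\<^esub> (r::nat)"
  shows "psi n q m p \<in> I [^]\<^bsub>ideals_set R\<^esub> r"
proof -
  have "psi n q m p = (\<Sum>e\<in>keys p. psi n q m (Poly_Mapping.single e (lookup p e)))"
    by (subst sum_of_monomials[of p]) (simp only: psi_def mp_subst_sum)
  also have "\<dots> \<in> I [^]\<^bsub>ideals_set R\<^esub> r"
  proof (rule ideal_sum_closed[OF I.ideal_power[unfolded R], folded R])
    fix e assume e: "e \<in> keys p"
    have ke: "keys e \<subseteq> sets"
      using p e unfolding E.I_power_eq_covers monomial_set_def mpoly_ring_carrier by blast
    have "covers sets_containing q r (lookup e)"
      using p e unfolding E.I_power_eq_covers monomial_set_def by blast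
    then have "covers F q r (lookup (pull e))" by (rule covers_pull)
    then show "psi n q m (Poly_Mapping.single e (lookup p e)) \<in> I [^]\<^bsub>ideals_set R\<^esub> r"
      unfolding psi_single[OF ke] I.I_power_eq_covers monomial_set_def mpoly_ring_carrier
      using keys_pull[of e] by simp
  qed
  finally show ?thesis .
qed

text \<open>
  The homomorphism \<open>\<psi>\<close> maps the powers of the extremal ideal into those of \<open>I\<close>, hence it maps
  integral equations to integral equations.
\<close>

lemma psi_integral:
  assumes z: "z \<in> integral_closure S (extremal_ideal q [^]\<^bsub>ideals_set S\<^esub> (r::nat))"
  shows "psi n q m z \<in> integral_closure R (I [^]\<^bsub>ideals_set R\<^esub> r)"
proof -
  obtain d a where d: "d \<ge> 1"
    and a: "\<forall>i\<in>{1..d}. a i \<in> extremal_ideal q [^]\<^bsub>ideals_set S\<^esub> (r * i)"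
    and eq: "z ^ d + (\<Sum>i\<in>{1..d}. a i * z ^ (d - i)) = 0"
    using z unfolding E.integral_closure_power_iff by blast
  let ?\<psi> = "psi n q m"
  have "?\<psi> (z ^ d + (\<Sum>i\<in>{1..d}. a i * z ^ (d - i))) = 0"
    unfolding eq by (simp add: psi_def mp_subst_0)
  then have "?\<psi> z ^ d + (\<Sum>i\<in>{1..d}. ?\<psi> (a i) * ?\<psi> z ^ (d - i)) = 0"
    by (simp add: psi_def mp_subst_add mp_subst_sum mp_subst_mult mp_subst_power)
  moreover have "\<forall>i\<in>{1..d}. ?\<psi> (a i) \<in> I [^]\<^bsub>ideals_set R\<^esub> (r * i)"
    using a psi_power by blast
  moreover have "?\<psi> z \<in> carrier R" unfolding R by (rule psi_closed)
  ultimately show ?thesis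
    unfolding I.integral_closure_power_iff using d by (intro conjI exI[of _ d] exI[of _ "\<lambda>i. ?\<psi> (a i)"])
qed

text \<open>
  The smallest integral exponent at a type \<open>A\<close> above the fractional load is the ceiling of
  \<open>load a A / N\<close>. It does not exceed \<open>b k\<close> for any variable \<open>k\<close> of type \<open>A\<close>, as \<open>b k\<close> is an integer
  above the same load.
\<close>

lemma frac_covers_lift:
  assumes "frac_covers F q r b"
  obtains e where "keys e \<subseteq> sets" "frac_covers sets_containing q r (lookup e)"
    "\<And>k. lookup (pull e) k \<le> b k"
proof -
  obtain N a where N: "N \<ge> 1" and a: "(\<Sum>j\<in>{1..q}. a j) = N * r"
    "\<And>k. load F q a k \<le> N * b k"
    using assms unfolding frac_covers_def covers_def by blast
  \<comment> \<open>the ceiling of \<open>load a A / N\<close>\<close>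
  define \<beta> where "\<beta> A = (load sets_containing q a A + (N - 1)) div N" for A
  define e where "e = exponent_of sets \<beta>"
  have e: "lookup e A = (if A \<in> sets then \<beta> A else 0)" for A
    unfolding e_def by (rule lookup_exponent_of) simp
  have "load sets_containing q a A \<le> N * lookup e A" for A
  proof (cases "A \<in> sets")
    case True
    let ?l = "load sets_containing q a A"
    have "(?l + (N - 1)) mod N < N" using N by simp
    then have "?l \<le> N * \<beta> A" using mult_div_mod_eq[of N "?l + (N - 1)"] unfolding \<beta>_def by linarith
    then show ?thesis using True e by simp
  next
    case False
    then show ?thesis using load_extremal_outside[of A a] by simp
  qed
  then have "covers sets_containing q (N * r) (\<lambda>A. N * lookup e A)" using a(1) by (intro coversI)
  then have "frac_covers sets_containing q r (lookup e)" using N unfolding frac_covers_def by blast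
  moreover have "keys e \<subseteq> sets" unfolding e_def by (rule keys_exponent_of) simp
  moreover have "lookup (pull e) k \<le> b k" for k
  proof -
    have "\<beta> (type_of k) \<le> (N * b k + (N - 1)) div N"
      unfolding \<beta>_def load_extremal using a(2)[of k] by (intro div_le_mono) simp
    also have "\<dots> = b k" using N by (intro div_nat_eqI) simp_all
    finally show ?thesis unfolding lookup_pull e by simp
  qed
  ultimately show ?thesis using that by blast
qed

text \<open>
  A monomial of the integral closure is a multiple of the image of its lift to the extremal ring.
  If the lift lies in the power of the extremal ideal, the monomial already lies in \<open>I\<^sup>r\<close>;
  otherwise the image is one of the additional generators.
\<close>

lemma integral_closure_eq_sum:
  "integral_closure R (I [^]\<^bsub>ideals_set R\<^esub> (r::nat)) = I [^]\<^bsub>ideals_set R\<^esub> r <+>\<^bsub>R\<^esub>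
    Idl\<^bsub>R\<^esub> (psi n q m ` (integral_closure S (extremal_ideal q [^]\<^bsub>ideals_set S\<^esub> r)
      - extremal_ideal q [^]\<^bsub>ideals_set S\<^esub> r))" (is "?C = ?P <+>\<^bsub>R\<^esub> ?L")
proof
  let ?G = "psi n q m ` (integral_closure S (extremal_ideal q [^]\<^bsub>ideals_set S\<^esub> r)
      - extremal_ideal q [^]\<^bsub>ideals_set S\<^esub> r)"
  have G: "?G \<subseteq> carrier R" unfolding R using psi_closed by blast
  have L: "ideal ?L R" by (rule I.R.genideal_ideal[OF G])
  have PL: "ideal (?P <+>\<^bsub>R\<^esub> ?L) R" by (rule I.R.add_ideals[OF I.ideal_power L])
  have C: "ideal ?C R"
    unfolding I.integral_closure_power_eq by (subst R) (rule ideal_monomial_frac_covers)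
  have P0: "0 \<in> ?P" and L0: "0 \<in> ?L"
    using additive_subgroup.zero_closed[OF ideal.axioms(1)[OF I.ideal_power]]
      additive_subgroup.zero_closed[OF ideal.axioms(1)[OF L]] unfolding R by simp_all
  have P_sub: "x + 0 \<in> ?P <+>\<^bsub>R\<^esub> ?L" if "x \<in> ?P" for x
    by (rule set_add_memI[OF R that L0])
  have L_sub: "0 + x \<in> ?P <+>\<^bsub>R\<^esub> ?L" if "x \<in> ?L" for x
    by (rule set_add_memI[OF R P0 that])
  show "?C \<subseteq> ?P <+>\<^bsub>R\<^esub> ?L"
  proof
    fix p assume p: "p \<in> ?C"
    show "p \<in> ?P <+>\<^bsub>R\<^esub> ?L"
    proof (rule in_ideal_if_monomials[OF PL[unfolded R], folded R])
      fix b assume b: "b \<in> keys p"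
      have kb: "keys b \<subseteq> {1..n}" and frac: "frac_covers F q r (lookup b)"
        using p b unfolding I.integral_closure_power_eq monomial_set_def mpoly_ring_carrier by blast+
      obtain e where e: "keys e \<subseteq> sets" "frac_covers sets_containing q r (lookup e)"
        "\<And>k. lookup (pull e) k \<le> lookup b k"
        using frac by (rule frac_covers_lift) blast
      show "xpow b \<in> ?P <+>\<^bsub>R\<^esub> ?L"
      proof (cases "covers sets_containing q r (lookup e)")
        case True
        from covers_mono[OF covers_pull[OF True] e(3)] have "xpow b \<in> ?P"
          unfolding I.xpow_in_power_iff[OF kb] .
        from P_sub[OF this] show ?thesis by simp
      next
        case False
        have "xpow e \<in> integral_closure S (extremal_ideal q [^]\<^bsub>ideals_set S\<^esub> r)
            - extremal_ideal q [^]\<^bsub>ideals_set S\<^esub> r"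
          using E.xpow_integral[OF e(1,2)] False unfolding E.xpow_in_power_iff[OF e(1), symmetric] by blast
        then have "psi n q m (xpow e) \<in> ?L" using I.R.genideal_self[OF G] by blast
        then have "xpow (pull e) \<in> ?L" unfolding psi_single[OF e(1)] .
        moreover have "xpow (b - pull e) \<in> carrier R"
          unfolding R using kb by (intro xpow_closed) (auto simp: in_keys_iff lookup_minus)
        ultimately have "xpow (b - pull e) \<otimes>\<^bsub>R\<^esub> xpow (pull e) \<in> ?L" by (rule ideal.I_l_closed[OF L])
        then have "xpow (b - pull e) * xpow (pull e) \<in> ?L" by (simp only: R mpoly_ring_simps)
        moreover have "b - pull e + pull e = b"
          using e(3) exponent_minus_add[of "pull e" b] by (simp add: add.commute)
        ultimately have "xpow b \<in> ?L" by (simp add: xpow_add[symmetric])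
        from L_sub[OF this] show ?thesis by simp
      qed
    qed
  qed
  have "?L \<subseteq> ?C" using psi_integral by (intro I.R.genideal_minimal[OF C]) blast
  then show "?P <+>\<^bsub>R\<^esub> ?L \<subseteq> ?C"
    by (rule set_add_subset_ideal[OF C I.power_subset_integral_closure])
qed

text \<open>
  The weights \<open>1/2\<close> on the generators \<open>1, \<dots>, 4\<close> load a set \<open>A\<close> by at most \<open>min (card A) 4 / 2\<close>, which
  is at most \<open>1\<close> if \<open>card A \<le> 2\<close> and at most \<open>2\<close> otherwise: these are the exponents of the first two
  factors of \<open>g\<close>. The last factor is \<open>r - 2\<close> copies of the first generator.
\<close>

lemma extremal_g_integral:
  assumes r: "r \<ge> 2" and q: "q \<ge> 4"
  shows "extremal_g r q \<in> integral_closure S (extremal_ideal q [^]\<^bsub>ideals_set S\<^esub> r)"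
proof -
  define x where "x i = exponent_of {A. A \<subseteq> {1..q} \<and> i \<le> card A} (\<lambda>_. 1 :: nat)" for i
  define y where "y = exponent_of (sets_containing 1) (\<lambda>_. 1 :: nat)"
  define e where "e = x 1 + x 3 + (\<Sum>i<r - 2. y)"
  have fin: "finite {A. A \<subseteq> {1..q} \<and> P A}" for P
    by (rule finite_subset[of _ "Pow {1..q}"]) auto
  have x: "lookup (x i) A = of_bool (A \<subseteq> {1..q} \<and> i \<le> card A)" for i A
    unfolding x_def by (simp add: lookup_exponent_of fin)
  have y: "lookup y A = of_bool (A \<in> sets_containing 1)" for A
    unfolding y_def by (simp add: lookup_exponent_of fin)
  have g: "extremal_g r q = xpow e"
    unfolding extremal_g_def extremal_gen_def prod_mp_var xpow_power e_def x_def y_def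
    by (simp add: mult_single)
  have "keys (x i) \<subseteq> sets" if "i \<ge> 1" for i
  proof
    fix A assume "A \<in> keys (x i)"
    then have "A \<subseteq> {1..q}" "i \<le> card A" by (simp_all add: in_keys_iff x)
    moreover from this that have "A \<noteq> {}" by auto
    ultimately show "A \<in> sets" by blast
  qed
  moreover have "keys (\<Sum>i<r - 2. y) \<subseteq> sets"
  proof
    fix A assume "A \<in> keys (\<Sum>i<r - 2. y)"
    then have "A \<in> sets_containing 1" by (simp add: in_keys_iff lookup_sum y)
    then show "A \<in> sets" by blast
  qed
  ultimately have ke: "keys e \<subseteq> sets"
    unfolding e_def by (intro order_trans[OF Poly_Mapping.keys_add] Un_least) auto
  have "frac_covers sets_containing q 2 (\<lambda>A. lookup (x 1) A + lookup (x 3) A)"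
  proof -
    let ?a = "\<lambda>j. if j \<in> {1..4} then 1 else (0::nat)"
    have "covers sets_containing q (2 * 2) (\<lambda>A. 2 * (lookup (x 1) A + lookup (x 3) A))"
    proof (rule coversI[where a = ?a])
      have "(\<Sum>j\<in>{1..q}. ?a j) = (\<Sum>j\<in>{1..4::nat}. 1)"
        using q by (intro sum.mono_neutral_cong_right) auto
      then show tot: "(\<Sum>j\<in>{1..q}. ?a j) = 2 * 2" by simp
      fix A
      show "load sets_containing q ?a A \<le> 2 * (lookup (x 1) A + lookup (x 3) A)"
      proof (cases "A \<in> sets")
        case True
        then have A: "A \<subseteq> {1..q}" "A \<noteq> {}" by auto
        then have "card A \<ge> 1" using finite_subset[OF A(1)] by (simp add: Suc_le_eq card_gt_0_iff)
        have "load sets_containing q ?a A \<le> (\<Sum>j\<in>{j \<in> {1..q}. A \<in> sets_containing j}. 1)"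
          unfolding load_def by (intro sum_mono) simp
        also have "\<dots> = card {j \<in> {1..q}. A \<in> sets_containing j}" by simp
        also have "\<dots> \<le> card A" using finite_subset[OF A(1)] by (intro card_mono) auto
        finally have "load sets_containing q ?a A \<le> card A" .
        moreover have "load sets_containing q ?a A \<le> 4"
          using load_le_total[of sets_containing q ?a A] tot by simp
        ultimately show ?thesis using A(1) \<open>card A \<ge> 1\<close> unfolding x by (auto simp: of_bool_def)
      next
        case False
        then show ?thesis using load_extremal_outside[OF False, of ?a] by simp
      qed
    qed
    then show ?thesis unfolding frac_covers_def by (intro exI[of _ 2]) simp
  qed
  moreover have "covers sets_containing q (r - 2) (lookup (\<Sum>i<r - 2. y))"
  proof -
    have "covers sets_containing q 1 (lookup y)"
      unfolding covers_1_iff using q by (auto simp: y intro!: bexI[of _ 1])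
    from covers_scale[OF this, of "r - 2"] show ?thesis by (simp add: lookup_sum[abs_def])
  qed
  ultimately have "frac_covers sets_containing q (2 + (r - 2))
      (\<lambda>A. lookup (x 1) A + lookup (x 3) A + lookup (\<Sum>i<r - 2. y) A)"
    by (intro frac_covers_add[OF _ covers_imp_frac_covers])
  moreover have "2 + (r - 2) = r" using r by simp
  moreover have "lookup e = (\<lambda>A. lookup (x 1) A + lookup (x 3) A + lookup (\<Sum>i<r - 2. y) A)"
    by (rule ext) (simp only: e_def lookup_add)
  ultimately have "frac_covers sets_containing q r (lookup e)" by (simp only:)
  then show ?thesis unfolding g by (rule E.xpow_integral[OF ke])
qed

end

section \<open>Integral closure formula and criteria for few generators\<close>

theorem theorem2:
  fixes n q r :: nat
    and R :: "(nat, 'k::field) mpoly ring"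
    and S :: "(nat set, 'k) mpoly ring"
    and m :: "nat \<Rightarrow> (nat, 'k) mpoly"
    and I :: "(nat, 'k) mpoly set"
  assumes R: "R = mpoly_ring {1..n}"
    and S: "S = extremal_ring q"
    and q: "q \<ge> 1"
    and m: "\<forall>j\<in>{1..q}. squarefree_monomial {1..n} (m j)"
    and I: "minimally_generated_by R I q m"
    and r: "r \<ge> 1"
  shows
    "(integral_closure R (I [^]\<^bsub>ideals_set R\<^esub> r) =
        I [^]\<^bsub>ideals_set R\<^esub> r <+>\<^bsub>R\<^esub>
        Idl\<^bsub>R\<^esub> (psi n q m `
          (integral_closure S (extremal_ideal q [^]\<^bsub>ideals_set S\<^esub> r)
            - extremal_ideal q [^]\<^bsub>ideals_set S\<^esub> r)))
    \<and> (r \<ge> 2 \<and> q \<ge> 4 \<and> psi n q m (extremal_g r q) \<notin> I [^]\<^bsub>ideals_set R\<^esub> r \<longrightarrow>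
        integral_closure R (I [^]\<^bsub>ideals_set R\<^esub> r) \<noteq> I [^]\<^bsub>ideals_set R\<^esub> r)
    \<and> (q \<le> 3 \<longrightarrow>
        integral_closure R (I [^]\<^bsub>ideals_set R\<^esub> r) = I [^]\<^bsub>ideals_set R\<^esub> r)
    \<and> (q = 4 \<longrightarrow>
        ((\<forall>s::nat. s \<ge> 1 \<longrightarrow>
            integral_closure R (I [^]\<^bsub>ideals_set R\<^esub> s) = I [^]\<^bsub>ideals_set R\<^esub> s)
          \<longleftrightarrow> integral_closure R (I [^]\<^bsub>ideals_set R\<^esub> (2::nat)) = I [^]\<^bsub>ideals_set R\<^esub> (2::nat))
        \<and> (integral_closure R (I [^]\<^bsub>ideals_set R\<^esub> (2::nat)) = I [^]\<^bsub>ideals_set R\<^esub> (2::nat)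
          \<longleftrightarrow> (\<exists>a b c d. {a, b, c, d} = {1, 2, 3, 4} \<and>
                somegcd R (m a) (m b) divides\<^bsub>R\<^esub> somelcm R (m c) (m d))))
    \<and> (q = 5 \<longrightarrow>
        ((\<forall>s::nat. s \<ge> 1 \<longrightarrow>
            integral_closure R (I [^]\<^bsub>ideals_set R\<^esub> s) = I [^]\<^bsub>ideals_set R\<^esub> s)
          \<longleftrightarrow> integral_closure R (I [^]\<^bsub>ideals_set R\<^esub> (2::nat)) = I [^]\<^bsub>ideals_set R\<^esub> (2::nat)
            \<and> integral_closure R (I [^]\<^bsub>ideals_set R\<^esub> (3::nat)) = I [^]\<^bsub>ideals_set R\<^esub> (3::nat)))"
proof -
  have "\<forall>j\<in>{1..q}. \<exists>G. G \<subseteq> {1..n} \<and> m j = (\<Prod>v\<in>G. mp_var v)"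
    using m unfolding squarefree_monomial_def by blast
  from bchoice[OF this] obtain F where
    F: "\<And>j. j \<in> {1..q} \<Longrightarrow> F j \<subseteq> {1..n}" and mF: "\<And>j. j \<in> {1..q} \<Longrightarrow> m j = (\<Prod>v\<in>F j. mp_var v)"
    by blast
  interpret extremal_comparison n q F m R I S
    using F mF R S I unfolding minimally_generated_by_def by unfold_locales blast+
  let ?closed = "\<lambda>s::nat. integral_closure R (I [^]\<^bsub>ideals_set R\<^esub> s) = I [^]\<^bsub>ideals_set R\<^esub> s"
  have closed_if: "?closed s" if "\<And>\<rho>. 2 \<le> \<rho> \<Longrightarrow> \<rho> + 2 \<le> q \<Longrightarrow> reduced_rounding F q \<rho>" for s
    unfolding I.power_integrally_closed_iff by (intro allI impI covers_if_frac_covers[OF q that])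
  have rounding: "reduced_rounding F q s" if "?closed s" for s
    using that unfolding I.power_integrally_closed_iff by (intro reduced_rounding_if_frac) simp
  have part2: "\<not> ?closed r" if "r \<ge> 2" "q \<ge> 4" "psi n q m (extremal_g r q) \<notin> I [^]\<^bsub>ideals_set R\<^esub> r"
    using psi_integral[OF extremal_g_integral[OF that(1,2)]] that(3) by auto
  have part3: "?closed r" if "q \<le> 3"
    by (rule closed_if) (use that in linarith)
  have part4: "(\<forall>s\<ge>1. ?closed s) \<longleftrightarrow> ?closed 2" if q4: "q = 4"
  proof
    assume "?closed 2"
    have "reduced_rounding F q \<rho>" if \<rho>: "2 \<le> \<rho>" "\<rho> + 2 \<le> q" for \<rho>
    proof -
      have "\<rho> = 2" using \<rho> q4 by linarith
      then show ?thesis using rounding[OF \<open>?closed 2\<close>] by simp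
    qed
    then show "\<forall>s\<ge>1. ?closed s" by (intro allI impI closed_if)
  qed simp
  have gcd_lcm: "(\<exists>a b c d. {a, b, c, d} = {1, 2, 3, 4} \<and>
      somegcd R (m a) (m b) divides\<^bsub>R\<^esub> somelcm R (m c) (m d)) \<longleftrightarrow>
    (\<exists>a b c d. {a, b, c, d} = {1, 2, 3, 4} \<and> F a \<inter> F b \<subseteq> F c \<union> F d)" if q4: "q = 4"
  proof -
    have *: "somegcd R (m a) (m b) divides\<^bsub>R\<^esub> somelcm R (m c) (m d) \<longleftrightarrow> F a \<inter> F b \<subseteq> F c \<union> F d"
      if "{a, b, c, d} = {1, 2, 3, 4}" for a b c d
    proof -
      have abcd: "a \<in> {1..q}" "b \<in> {1..q}" "c \<in> {1..q}" "d \<in> {1..q}"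
      proof -
        have "{1..q} = {a, b, c, d}" unfolding that q4 by auto
        then show "a \<in> {1..q}" "b \<in> {1..q}" "c \<in> {1..q}" "d \<in> {1..q}" by simp_all
      qed
      show ?thesis
        unfolding mF[OF abcd(1)] mF[OF abcd(2)] mF[OF abcd(3)] mF[OF abcd(4)] prod_mp_var
        by (rule somegcd_divides_somelcm_iff[OF finite_atLeastAtMost R F[OF abcd(1)] F[OF abcd(2)]
              F[OF abcd(3)] F[OF abcd(4)]])
    qed
    show ?thesis by (intro ex_cong1 conj_cong refl *)
  qed
  have missing_pair: "?closed 2 \<longleftrightarrow> (\<exists>a b c d. {a, b, c, d} = {1, 2, 3, 4} \<and> F a \<inter> F b \<subseteq> F c \<union> F d)" if q4: "q = 4"
  proof
    assume "?closed 2"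
    then show "\<exists>a b c d. {a, b, c, d} = {1, 2, 3, 4} \<and> F a \<inter> F b \<subseteq> F c \<union> F d"
      unfolding I.power_integrally_closed_iff q4 by (intro rounding_imp_pair_missing) simp
  next
    assume "\<exists>a b c d. {a, b, c, d} = {1, 2, 3, 4} \<and> F a \<inter> F b \<subseteq> F c \<union> F d"
    then have "reduced_rounding F 4 2" by (elim exE conjE) (rule reduced_rounding_4_2)
    moreover have "\<rho> = 2" if "2 \<le> \<rho>" "\<rho> + 2 \<le> q" for \<rho> using that q4 by linarith
    ultimately show "?closed 2" using q4 by (intro closed_if) simp
  qed
  have part4_gcd: "?closed 2 \<longleftrightarrow> (\<exists>a b c d. {a, b, c, d} = {1, 2, 3, 4} \<and>
      somegcd R (m a) (m b) divides\<^bsub>R\<^esub> somelcm R (m c) (m d))" if "q = 4"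
    unfolding gcd_lcm[OF that] by (rule missing_pair[OF that])
  have part5: "(\<forall>s\<ge>1. ?closed s) \<longleftrightarrow> ?closed 2 \<and> ?closed 3" if q5: "q = 5"
  proof
    assume c23: "?closed 2 \<and> ?closed 3"
    have "reduced_rounding F q \<rho>" if \<rho>: "2 \<le> \<rho>" "\<rho> + 2 \<le> q" for \<rho>
    proof -
      have "\<rho> = 2 \<or> \<rho> = 3" using \<rho> q5 by linarith
      then show ?thesis using rounding[of 2] rounding[of 3] c23 by auto
    qed
    then show "\<forall>s\<ge>1. ?closed s" by (intro allI impI closed_if)
  qed simp
  show ?thesis
    by (intro conjI impI integral_closure_eq_sum part2 part3 part4 part4_gcd part5) simp_all
qed

end
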